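(* Let $Q=((A,V);B;\alpha)$ be as in the context. Then: (1) For every scale function $\varphi$, $\mathfrak B_\varphi(Q)$ is comeager in $A\hat\otimes_\alpha B$ (contains a countable intersection of dense open sets). (2) $A\hat\otimes_\alpha B=\bigcup_\varphi\mathfrak B_\varphi(Q)$ and $V\otimes B=\bigcap_\varphi\mathfrak B_\varphi(Q)$, where union and intersection are over all scale functions; moreover, for every countable set $\Phi$ of scale functions, $A\hat\otimes_\alpha B\setminus\bigcup_{\varphi\in\Phi}\mathfrak B_\varphi(Q)\neq\emptyset$. (3) For every countable set $\Phi$ of scale functions there are scale functions $\varphi_{lb},\varphi_{ub}$ with $\mathfrak B_{\varphi_{lb}}(Q)\subset\bigcap_{\varphi\in\Phi}\mathfrak B_\varphi(Q)\subset\bigcup_{\varphi\in\Phi}\mathfrak B_\varphi(Q)\subset\mathfrak B_{\varphi_{ub}}(Q)$. (4) For scale functions $\varphi,\varphi'$: $\mathfrak B_{\varphi'}(Q)\subset\mathfrak B_\varphi(Q)$ if and only if $\varphi'\le c\varphi$ for some constant $c\in(0,\infty)$. In particular $\mathfrak B_{\varphi^2}(Q)\subsetneq\mathfrak B_\varphi(Q)\subsetneq\mathfrak B_{\sqrt\varphi}(Q)$.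
   Context: $\mathbb F\in\{\mathbb R,\mathbb C\}$. $A$ is an infinite-dimensional separable Banach space over $\mathbb F$ and $V_0\subsetneq V_1\subsetneq\cdots\subset A$ are finite-dimensional subspaces whose union $V=\bigcup_iV_i$ is dense in $A$. $B$ is a Banach space over $\mathbb F$, $\alpha$ a reasonable crossnorm on $A\otimes B$ (i.e. $\alpha(a\otimes b)=\|a\|\|b\|$ and the dual norm satisfies $\alpha'(a^*\otimes b^* )=\|a^*\|\|b^*\|$), and $A\hat\otimes_\alpha B$ the completion; $Q=((A,V);B;\alpha)$. For $x\in A\hat\otimes_\alpha B$, $E_n(x):=\inf_{h\in V_n\otimes B}\|x-h\|_{A\hat\otimes_\alpha B}$. A scale function is a nonincreasing $\varphi:\mathbb N\to(0,\infty)$ with $\lim_n\varphi(n)=0$. $\mathfrak B_\varphi(Q)$ is the set of $x\in A\hat\otimes_\alpha B$ with $\liminf_{n\to\infty}(E_n(x))^{\varphi(n)}<1$. *)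

theory Defs
  imports "HOL-Analysis.Analysis"
begin

text \<open>Scalar field F is modelled by a type 'k of class real_normed_field (every such
  field is R or C up to isometric isomorphism, Mazur).  A Banach space over F is a
  real Banach space type with a compatible F-scalar multiplication.\<close>

definition F_normed_space :: "('k::real_normed_field \<Rightarrow> 'a::real_normed_vector \<Rightarrow> 'a) \<Rightarrow> bool" where
  "F_normed_space smul \<longleftrightarrow>
     (\<forall>c d x. smul c (smul d x) = smul (c * d) x) \<and>
     (\<forall>x. smul 1 x = x) \<and>
     (\<forall>c x y. smul c (x + y) = smul c x + smul c y) \<and>
     (\<forall>c d x. smul (c + d) x = smul c x + smul d x) \<and>
     (\<forall>c x. norm (smul c x) = norm c * norm x) \<and>
     (\<forall>r x. smul (of_real r) x = scaleR r x)"

definition F_functional :: "('k::real_normed_field \<Rightarrow> 'a::real_normed_vector \<Rightarrow> 'a) \<Rightarrow> ('a \<Rightarrow> 'k) \<Rightarrow> bool" where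
  "F_functional smul f \<longleftrightarrow> bounded_linear f \<and> (\<forall>c x. f (smul c x) = c * f x)"

definition F_span :: "('k::real_normed_field \<Rightarrow> 'a::real_normed_vector \<Rightarrow> 'a) \<Rightarrow> 'a set \<Rightarrow> 'a set" where
  "F_span smul S = {\<Sum>v\<in>S. smul (c v) v | c. True}"

text \<open>Image of the algebraic tensor product S \<otimes> T (S a subspace) under the map t:
  all finite sums of elementary tensors.\<close>
definition tspan :: "('a \<Rightarrow> 'b \<Rightarrow> 'x::real_vector) \<Rightarrow> 'a set \<Rightarrow> 'b set \<Rightarrow> 'x set" where
  "tspan t S T = {\<Sum>i<n. t (a i) (b i) | (n::nat) (a::nat \<Rightarrow> 'a) (b::nat \<Rightarrow> 'b). \<forall>i<n. a i \<in> S \<and> b i \<in> T}"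

definition scale_fun :: "(nat \<Rightarrow> real) \<Rightarrow> bool" where
  "scale_fun \<phi> \<longleftrightarrow> antimono \<phi> \<and> (\<forall>n. 0 < \<phi> n) \<and> \<phi> \<longlonglongrightarrow> 0"

definition E_n :: "('a \<Rightarrow> 'b \<Rightarrow> 'x::real_normed_vector) \<Rightarrow> (nat \<Rightarrow> 'a set) \<Rightarrow> nat \<Rightarrow> 'x \<Rightarrow> real" where
  "E_n t V n x = infdist x (tspan t (V n) UNIV)"

definition B_phi :: "('a \<Rightarrow> 'b \<Rightarrow> 'x::real_normed_vector) \<Rightarrow> (nat \<Rightarrow> 'a set) \<Rightarrow> (nat \<Rightarrow> real) \<Rightarrow> 'x set" where
  "B_phi t V \<phi> = {x. liminf (\<lambda>n. ereal (E_n t V n x powr \<phi> n)) < 1}"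

end

theory Submission
  imports Defs "HOL-Computational_Algebra.Fundamental_Theorem_Algebra"
begin

text \<open>Put \<open>W n = V n \<otimes> B\<close>.  Testing against functionals \<open>f \<otimes> g\<close> shows that every \<open>W n\<close> is a closed
  subspace, strictly contained in \<open>W (n + 1)\<close>; this needs the Hahn--Banach theorem over the scalar
  field, hence the fact that this field is the reals or the complexes.  Membership of \<open>x\<close> in
  \<open>B_phi t V \<phi>\<close> means \<open>E n x \<le> exp (- d / \<phi> n)\<close> infinitely often for some \<open>d > 0\<close>.  To separate
  \<open>\<phi>'\<close> from \<open>\<phi>\<close> when \<open>\<phi>' / \<phi>\<close> is unbounded, one chooses a sparse sequence \<open>r j\<close> along which the
  ratio tends to infinity and sums unit vectors of \<open>W (r (j + 1))\<close> far from \<open>W (r (j + 1) - 1)\<close>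
  with weights \<open>exp (- 1 / \<phi>' (r j))\<close>: the approximation error is comparable to the
  \<open>j\<close>-th weight from \<open>r j\<close> until just before \<open>r (j + 1)\<close>.\<close>

section \<open>The Hahn--Banach theorem\<close>

text \<open>Since \<open>'b\<close> may be infinite-dimensional, closedness of \<open>W n\<close> is
  not a finite-dimensional fact. Generators of \<open>V n\<close> are adjoined one at a time, and
  the bound \<open>norm b \<le> C * norm (w + t v b)\<close> makes the coordinate along the new
  generator continuous; the bounded functional behind it comes from the dual half of the crossnorm
  condition. Closedness pays twice: distance zero then means membership, which identifies the
  intersection over all scale functions with the algebraic tensor product, and Riesz's lemma yields
  the far unit vectors. The type class promises only a multiplicative norm, so making a real
  functional linear over \<open>'k\<close> needs the structure of the field, which is extracted from
  real quadratic equations. Constants may stay crude: closedness needs some \<open>C\<close>, and a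
  fixed factor in the error is absorbed by \<open>d\<close> because \<open>\<phi>\<close> tends to
  0. Hence no exact lethargy theorem is called for.\<close>

definition sublinear :: "('a::real_vector \<Rightarrow> real) \<Rightarrow> bool" where
  "sublinear q \<longleftrightarrow> (\<forall>x y. q (x + y) \<le> q x + q y) \<and> (\<forall>c\<ge>0. \<forall>x. q (c *\<^sub>R x) \<le> c * q x)"

lemma sublinear_add: "sublinear q \<Longrightarrow> q (x + y) \<le> q x + q y"
  and sublinear_scale_le: "sublinear q \<Longrightarrow> 0 \<le> c \<Longrightarrow> q (c *\<^sub>R x) \<le> c * q x"
  by (auto simp: sublinear_def)

lemma sublinear_zero: assumes "sublinear q" shows "q 0 = 0"
  using sublinear_scale_le[OF assms, of 0 0] sublinear_add[OF assms, of 0 0] by simp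

lemma sublinear_scale:
  assumes "sublinear q" "0 \<le> c" shows "q (c *\<^sub>R x) = c * q x"
proof (cases "c = 0")
  case False
  then have "q ((1/c) *\<^sub>R (c *\<^sub>R x)) \<le> (1/c) * q (c *\<^sub>R x)"
    by (intro sublinear_scale_le) (use assms in auto)
  then have "c * q x \<le> q (c *\<^sub>R x)"
    using False assms by (simp add: field_simps)
  then show ?thesis using sublinear_scale_le[OF assms, of x] by simp
qed (simp add: sublinear_zero assms)

lemma sublinear_minus_le: assumes "sublinear q" shows "- q (- x) \<le> q x"
  using sublinear_add[OF assms, of x "-x"] sublinear_zero[OF assms] by simp

text \<open>For sublinear \<open>q\<close>, this is the largest sublinear minorant \<open>r\<close>
  of \<open>q\<close> with \<open>r (- y) \<le> - q y\<close>. A linear functional below it must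
  therefore attain \<open>q y\<close> at \<open>y\<close>.\<close>

definition sublinear_shift :: "('a::real_vector \<Rightarrow> real) \<Rightarrow> 'a \<Rightarrow> 'a \<Rightarrow> real" where
  "sublinear_shift q y x = (INF s\<in>{0..}. q (x + s *\<^sub>R y) - s * q y)"

lemma sublinear_shift_bdd:
  assumes "sublinear q" shows "bdd_below ((\<lambda>s. q (x + s *\<^sub>R y) - s * q y) ` {0..})"
proof (rule bdd_belowI2)
  fix s :: real assume "s \<in> {0..}"
  then show "- q (- x) \<le> q (x + s *\<^sub>R y) - s * q y"
    using sublinear_add[OF assms, of "x + s *\<^sub>R y" "-x"] sublinear_scale[OF assms, of s y] by simp
qed

lemma sublinear_shift_le_at:
  assumes "sublinear q" "0 \<le> s" shows "sublinear_shift q y x \<le> q (x + s *\<^sub>R y) - s * q y"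
  unfolding sublinear_shift_def
  by (rule cINF_lower[OF sublinear_shift_bdd[OF assms(1)]]) (use assms in auto)

lemma sublinear_shift_le: "sublinear q \<Longrightarrow> sublinear_shift q y x \<le> q x"
  using sublinear_shift_le_at[of q 0 y x] by simp

text \<open>The range \<open>{0..}\<close> of the parameter is a cone: candidates with parameters
  \<open>s\<close> and \<open>s'\<close> combine to one with \<open>s + s'\<close>, and scaling by
  \<open>c\<close> turns \<open>s\<close> into \<open>c * s\<close>.\<close>

lemma sublinear_sublinear_shift:
  assumes q: "sublinear q" shows "sublinear (sublinear_shift q y)"
  unfolding sublinear_def
proof (intro conjI allI impI)
  fix x x'
  have "sublinear_shift q y (x + x') - (q (x' + s' *\<^sub>R y) - s' * q y) \<le> sublinear_shift q y x"
    if s': "0 \<le> s'" for s'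
    unfolding sublinear_shift_def[of q y x]
  proof (rule cINF_greatest)
    fix s :: real assume "s \<in> {0..}"
    then have "sublinear_shift q y (x + x') \<le> q ((x + x') + (s + s') *\<^sub>R y) - (s + s') * q y"
      by (intro sublinear_shift_le_at q) (use s' in auto)
    moreover have "q ((x + x') + (s + s') *\<^sub>R y) \<le> q (x + s *\<^sub>R y) + q (x' + s' *\<^sub>R y)"
      using sublinear_add[OF q, of "x + s *\<^sub>R y" "x' + s' *\<^sub>R y"] by (simp add: algebra_simps)
    ultimately show "sublinear_shift q y (x + x') - (q (x' + s' *\<^sub>R y) - s' * q y)
        \<le> q (x + s *\<^sub>R y) - s * q y"
      by (simp add: algebra_simps)
  qed simp
  then have "sublinear_shift q y (x + x') - sublinear_shift q y x \<le> sublinear_shift q y x'"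
    unfolding sublinear_shift_def[of q y x'] by (intro cINF_greatest) (auto simp: algebra_simps)
  then show "sublinear_shift q y (x + x') \<le> sublinear_shift q y x + sublinear_shift q y x'"
    by simp
next
  fix c :: real and x assume c: "0 \<le> c"
  show "sublinear_shift q y (c *\<^sub>R x) \<le> c * sublinear_shift q y x"
  proof (cases "c = 0")
    case True
    then show ?thesis using sublinear_shift_le[OF q, of y 0] sublinear_zero[OF q] by simp
  next
    case False
    have "sublinear_shift q y (c *\<^sub>R x) / c \<le> sublinear_shift q y x"
      unfolding sublinear_shift_def[of q y x]
    proof (rule cINF_greatest)
      fix s :: real assume "s \<in> {0..}"
      then have "sublinear_shift q y (c *\<^sub>R x) \<le> q (c *\<^sub>R x + (c * s) *\<^sub>R y) - (c * s) * q y"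
        by (intro sublinear_shift_le_at q) (use c in auto)
      also have "q (c *\<^sub>R x + (c * s) *\<^sub>R y) = c * q (x + s *\<^sub>R y)"
        using sublinear_scale[OF q c, of "x + s *\<^sub>R y"] by (simp add: scaleR_add_right)
      finally show "sublinear_shift q y (c *\<^sub>R x) / c \<le> q (x + s *\<^sub>R y) - s * q y"
        using False c by (simp add: field_simps)
    qed simp
    then show ?thesis using False c by (simp add: field_simps)
  qed
qed

text \<open>Provides lower bounds of chains for Zorn's lemma. The common majorant \<open>p\<close>
  keeps the infimum finite, since \<open>- p (- x) \<le> - q (- x) \<le> q x\<close>. For
  subadditivity, the smaller of two members of the chain serves both arguments.\<close>

lemma sublinear_INF:
  assumes C: "C \<noteq> {}" and sub: "\<And>q. q \<in> C \<Longrightarrow> sublinear q"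
    and chain: "\<And>q r. q \<in> C \<Longrightarrow> r \<in> C \<Longrightarrow> q \<le> r \<or> r \<le> q"
    and below: "\<And>q. q \<in> C \<Longrightarrow> q \<le> p"
  shows "sublinear (\<lambda>x. INF q\<in>C. q x)" and "r \<in> C \<Longrightarrow> (\<lambda>x. INF q\<in>C. q x) \<le> r"
proof -
  have bdd: "bdd_below ((\<lambda>q. q x) ` C)" for x
  proof (rule bdd_belowI2)
    fix q assume "q \<in> C"
    then show "- p (- x) \<le> q x"
      using sublinear_minus_le[OF sub, of q x] le_funD[OF below, of q "-x"] by simp
  qed
  have lower: "(INF q\<in>C. q x) \<le> r x" if "r \<in> C" for r x
    by (rule cINF_lower[OF bdd that])
  then show "r \<in> C \<Longrightarrow> (\<lambda>x. INF q\<in>C. q x) \<le> r" by (auto simp: le_fun_def)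
  show "sublinear (\<lambda>x. INF q\<in>C. q x)"
    unfolding sublinear_def
  proof (intro conjI allI impI)
    fix x y
    have "(INF q\<in>C. q (x + y)) \<le> r x + s y" if "r \<in> C" "s \<in> C" for r s
      using chain[OF that]
    proof
      assume "r \<le> s"
      then show ?thesis
        using lower[OF that(1), of "x + y"] sublinear_add[OF sub[OF that(1)], of x y] le_funD[of r s y]
        by linarith
    next
      assume "s \<le> r"
      then show ?thesis
        using lower[OF that(2), of "x + y"] sublinear_add[OF sub[OF that(2)], of x y] le_funD[of s r x]
        by linarith
    qed
    then have "(INF q\<in>C. q (x + y)) - s y \<le> (INF q\<in>C. q x)" if "s \<in> C" for s
      using that C by (intro cINF_greatest) (auto simp: algebra_simps)
    then have "(INF q\<in>C. q (x + y)) - (INF q\<in>C. q x) \<le> (INF q\<in>C. q y)"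
      using C by (intro cINF_greatest) (auto simp: algebra_simps)
    then show "(INF q\<in>C. q (x + y)) \<le> (INF q\<in>C. q x) + (INF q\<in>C. q y)" by simp
  next
    fix c :: real and x assume c: "0 \<le> c"
    show "(INF q\<in>C. q (c *\<^sub>R x)) \<le> c * (INF q\<in>C. q x)"
    proof (cases "c = 0")
      case True
      obtain r where "r \<in> C" using C by blast
      then show ?thesis using True lower[of r 0] sublinear_zero[OF sub[of r]] by simp
    next
      case False
      have "(INF q\<in>C. q (c *\<^sub>R x)) / c \<le> (INF q\<in>C. q x)"
      proof (rule cINF_greatest[OF C])
        fix r assume "r \<in> C"
        then show "(INF q\<in>C. q (c *\<^sub>R x)) / c \<le> r x"
          using lower[of r "c *\<^sub>R x"] sublinear_scale[OF sub[of r] c, of x] False c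
          by (simp add: field_simps)
      qed
      then show ?thesis using False c by (simp add: field_simps)
    qed
  qed
qed

text \<open>A minimal sublinear functional coincides with all its shifts, hence is additive.\<close>

lemma minimal_sublinear_linear:
  assumes q: "sublinear q" and min: "\<And>r. sublinear r \<Longrightarrow> r \<le> q \<Longrightarrow> r = q"
  shows "linear q"
proof -
  have eq: "sublinear_shift q y = q" for y
    by (rule min[OF sublinear_sublinear_shift[OF q]]) (simp add: le_fun_def sublinear_shift_le[OF q])
  have add: "q (x + y) = q x + q y" for x y
    using sublinear_shift_le_at[OF q, of 1 y x] sublinear_add[OF q, of x y] unfolding eq by simp
  have minus: "q (- x) = - q x" for x
    using add[of x "-x"] sublinear_zero[OF q] by simp
  have "q (c *\<^sub>R x) = c * q x" for c x
  proof (cases "0 \<le> c")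
    case False
    then have "q ((- c) *\<^sub>R x) = - c * q x" by (intro sublinear_scale[OF q]) auto
    then show ?thesis using minus[of "c *\<^sub>R x"] by simp
  qed (rule sublinear_scale[OF q])
  with add show ?thesis by (intro linearI) auto
qed

text \<open>Zorn's lemma runs over sublinear functionals instead of partial extensions. Starting
  below the shift of \<open>p\<close> at \<open>v\<close>, not just below \<open>p\<close>, fixes
  the value at \<open>v\<close> in advance.\<close>

theorem Hahn_Banach_sublinear:
  assumes p: "sublinear p"
  obtains u where "linear u" "\<And>x. u x \<le> p x" "u v = p v"
proof -
  let ?p = "sublinear_shift p v"
  define S where "S = {q. sublinear q \<and> q \<le> ?p}"
  have p': "sublinear ?p" by (rule sublinear_sublinear_shift[OF p])
  \<comment> \<open>The order is reversed, because a minimal element is wanted.\<close>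
  have "\<exists>m\<in>S. \<forall>q\<in>S. m \<ge> q \<longrightarrow> q = m"
  proof (rule predicate_Zorn)
    show "partial_order_on S (relation_of (\<ge>) S)"
      by (rule partial_order_on_relation_ofI) auto
  next
    fix C assume C: "C \<in> Chains (relation_of (\<ge>) S)"
    show "\<exists>u\<in>S. \<forall>q\<in>C. q \<ge> u"
    proof (cases "C = {}")
      case True
      then show ?thesis using p' by (auto simp: S_def)
    next
      case False
      have CS: "C \<subseteq> S" using C by (auto simp: Chains_def relation_of_def)
      have chain: "q \<le> r \<or> r \<le> q" if "q \<in> C" "r \<in> C" for q r
        using C that by (auto simp: Chains_def relation_of_def)
      note inf = sublinear_INF[of C ?p, OF False _ chain]
      have sub: "sublinear (\<lambda>x. INF q\<in>C. q x)" and le: "\<And>r. r \<in> C \<Longrightarrow> (\<lambda>x. INF q\<in>C. q x) \<le> r"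
        using inf CS by (auto simp: S_def subset_iff)
      obtain r where r: "r \<in> C" using False by blast
      have "(\<lambda>x. INF q\<in>C. q x) \<le> ?p"
        using le[OF r] CS r by (auto simp: S_def subset_iff intro: order_trans)
      then show ?thesis using sub le by (auto simp: S_def)
    qed
  qed
  then obtain u where u: "sublinear u" "u \<le> ?p" and min: "\<And>q. q \<in> S \<Longrightarrow> q \<le> u \<Longrightarrow> q = u"
    by (auto simp: S_def)
  have "linear u"
    by (rule minimal_sublinear_linear[OF u(1)]) (use u(2) min in \<open>auto simp: S_def intro: order_trans\<close>)
  moreover have le: "u x \<le> p x" for x
    using le_funD[OF u(2), of x] sublinear_shift_le[OF p, of v x] by simp
  \<comment> \<open>The parameter \<open>s = 1\<close> cancels \<open>- v\<close>; linearity of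
    \<open>u\<close> then gives \<open>p v \<le> u v\<close>.\<close>
  moreover have "u (- v) \<le> p 0 - p v"
    using le_funD[OF u(2), of "-v"] sublinear_shift_le_at[OF p, of 1 v "-v"] by simp
  then have "u v = p v"
    using le[of v] linear_neg[OF \<open>linear u\<close>, of v] sublinear_zero[OF p] by simp
  ultimately show ?thesis by (rule that)
qed

section \<open>The distance to a subspace as a seminorm\<close>

lemma infdist_subspace_add_mem:
  fixes M :: "'a::real_normed_vector set"
  assumes M: "subspace M" and m: "m \<in> M"
  shows "infdist (x + m) M = infdist x M"
proof -
  have le: "infdist (x + m) M \<le> infdist x M" if m: "m \<in> M" for x m
  proof -
    have "M \<noteq> {}" using m by blast
    moreover have "infdist (x + m) M \<le> dist x a" if "a \<in> M" for a
      using infdist_le[of "a + m" M "x + m"] subspace_add[OF M that m] by (simp add: dist_norm)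
    ultimately show ?thesis unfolding infdist_notempty[of M x, OF \<open>M \<noteq> {}\<close>]
      by (intro cINF_greatest) auto
  qed
  show ?thesis using le[OF m, of x] le[of "-m" "x + m"] subspace_neg[OF M m] by simp
qed

lemma infdist_subspace_le_norm:
  fixes M :: "'a::real_normed_vector set"
  assumes "subspace M" shows "infdist x M \<le> norm x"
  using infdist_le[OF subspace_0[OF assms], of x] by simp

lemma infdist_subspace_add:
  fixes M :: "'a::real_normed_vector set"
  assumes M: "subspace M" shows "infdist (x + y) M \<le> infdist x M + infdist y M"
proof -
  have ne: "M \<noteq> {}" using subspace_0[OF M] by blast
  have "infdist (x + y) M - dist y b \<le> dist x a" if "a \<in> M" "b \<in> M" for a b
  proof -
    have "infdist (x + y) M \<le> dist (x + y) (a + b)"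
      by (rule infdist_le[OF subspace_add[OF M that]])
    then show ?thesis using dist_triangle_add[of x y a b] by linarith
  qed
  then have "infdist (x + y) M - dist y b \<le> infdist x M" if "b \<in> M" for b
    unfolding infdist_notempty[OF ne, of x] using that ne by (intro cINF_greatest) auto
  then have "infdist (x + y) M - infdist x M \<le> infdist y M"
    unfolding infdist_notempty[OF ne, of y] using ne by (intro cINF_greatest) (auto simp: algebra_simps)
  then show ?thesis by simp
qed

lemma infdist_subspace_scale:
  fixes M :: "'a::real_normed_vector set"
  assumes M: "subspace M" shows "infdist (c *\<^sub>R x) M = \<bar>c\<bar> * infdist x M"
proof -
  have ne: "M \<noteq> {}" using subspace_0[OF M] by blast
  have le: "infdist (c *\<^sub>R x) M \<le> \<bar>c\<bar> * infdist x M" if c: "c \<noteq> 0" for c x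
  proof -
    have "infdist (c *\<^sub>R x) M / \<bar>c\<bar> \<le> infdist x M"
      unfolding infdist_notempty[OF ne, of x]
    proof (rule cINF_greatest[OF ne])
      fix a assume "a \<in> M"
      then have "infdist (c *\<^sub>R x) M \<le> dist (c *\<^sub>R x) (c *\<^sub>R a)"
        by (intro infdist_le subspace_scale[OF M])
      also have "\<dots> = \<bar>c\<bar> * dist x a"
        by (simp add: dist_norm flip: scaleR_diff_right)
      finally show "infdist (c *\<^sub>R x) M / \<bar>c\<bar> \<le> dist x a"
        using c by (simp add: field_simps)
    qed
    then show ?thesis using c by (simp add: field_simps)
  qed
  show ?thesis
  proof (cases "c = 0")
    case True
    then show ?thesis using subspace_0[OF M] by simp
  next
    case False
    have "\<bar>c\<bar> * infdist x M \<le> infdist (c *\<^sub>R x) M"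
      using le[of "1/c" "c *\<^sub>R x"] False by (simp add: field_simps)
    then show ?thesis using le[OF False, of x] by simp
  qed
qed

lemma subspace_closure_subspace:
  fixes M :: "'a::real_normed_vector set"
  assumes M: "subspace M" shows "subspace (closure M)"
proof -
  have iff: "x \<in> closure M \<longleftrightarrow> infdist x M = 0" for x
    using in_closure_iff_infdist_zero subspace_0[OF M] by blast
  have "infdist (x + y) M = 0" if "infdist x M = 0" "infdist y M = 0" for x y
    using infdist_subspace_add[OF M, of x y] infdist_nonneg[of "x + y" M] that by simp
  then show ?thesis
    using subspace_0[OF M] by (auto simp: subspace_def iff infdist_subspace_scale[OF M])
qed

text \<open>The distance to \<open>M\<close> vanishes on \<open>M\<close> and is at most the norm,
  so this one majorant encodes both annihilation of \<open>M\<close> and boundedness.\<close>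

corollary Hahn_Banach_infdist:
  fixes M :: "'a::real_normed_vector set"
  assumes M: "subspace M"
  obtains u where "linear u" "\<And>x. \<bar>u x\<bar> \<le> infdist x M" "u v = infdist v M"
proof -
  have "sublinear (\<lambda>x. infdist x M)"
    unfolding sublinear_def by (simp add: infdist_subspace_add[OF M] infdist_subspace_scale[OF M])
  then obtain u where u: "linear u" "\<And>x. u x \<le> infdist x M" "u v = infdist v M"
    using Hahn_Banach_sublinear[of "\<lambda>x. infdist x M" v] by blast
  have "\<bar>u x\<bar> \<le> infdist x M" for x
    using u(2)[of x] u(2)[of "-x"] linear_neg[OF u(1), of x] infdist_subspace_scale[OF M, of "-1" x]
    by simp
  with u show ?thesis by (intro that)
qed

section \<open>The Gelfand--Mazur theorem for normed fields\<close>

text \<open>Real polynomials are evaluated in two fields: at complex numbers to find factors, and at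
  elements of \<open>'k\<close> to estimate norms.\<close>

definition rpoly :: "real poly \<Rightarrow> 'k::real_normed_field \<Rightarrow> 'k" where
  "rpoly p x = poly (map_poly of_real p) x"

lemma rpoly_add: "rpoly (p + q) x = rpoly p x + rpoly q x"
proof -
  have "map_poly of_real (p + q) = map_poly of_real p + (map_poly of_real q :: 'a poly)"
    by (rule poly_eqI) (simp add: coeff_map_poly)
  then show ?thesis by (simp add: rpoly_def)
qed

lemma rpoly_mult: "rpoly (p * q) x = rpoly p x * rpoly q x"
proof -
  have "map_poly of_real (p * q) = map_poly of_real p * (map_poly of_real q :: 'a poly)"
    by (rule poly_eqI) (simp add: coeff_map_poly coeff_mult)
  then show ?thesis by (simp add: rpoly_def)
qed

lemma rpoly_pCons: "rpoly (pCons c p) x = of_real c + x * rpoly p x"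
  by (cases "pCons c p = 0") (auto simp: rpoly_def map_poly_pCons)

lemma rpoly_0 [simp]: "rpoly 0 x = 0" by (simp add: rpoly_def)

lemma rpoly_1 [simp]: "rpoly 1 x = 1" by (simp add: one_pCons rpoly_pCons)

lemma rpoly_const: "rpoly [:c:] x = of_real c" by (simp add: rpoly_pCons)

lemma rpoly_power: "rpoly (p ^ n) x = rpoly p x ^ n"
  by (induction n) (simp_all add: rpoly_mult)

lemma rpoly_diff: "rpoly (p - q) x = rpoly p x - rpoly q x"
  using rpoly_add[of "p - q" q x] by (simp add: algebra_simps)

text \<open>The monic real quadratic with roots \<open>z\<close> and its conjugate; for real
  \<open>z\<close> it is a square.\<close>

definition quad_poly :: "complex \<Rightarrow> real poly" where
  "quad_poly z = [:(cmod z)\<^sup>2, - 2 * Re z, 1:]"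

lemma rpoly_quad:
  "rpoly (quad_poly z) x = (x - of_real (Re z))\<^sup>2 + of_real ((Im z)\<^sup>2)"
  unfolding quad_poly_def cmod_power2 by (simp add: rpoly_pCons power2_eq_square algebra_simps)

lemma rpoly_quad_root: "rpoly (quad_poly z) z = 0"
  by (simp add: rpoly_quad complex_eq_iff power2_eq_square)

lemma degree_quad [simp]: "degree (quad_poly z) = 2" "lead_coeff (quad_poly z) = 1"
  by (simp_all add: quad_poly_def)

text \<open>For nonreal \<open>z\<close> the remainder modulo \<open>quad_poly z\<close> is a real
  polynomial of degree at most one that vanishes at \<open>z\<close>, hence zero. At a real root
  only a linear factor is guaranteed.\<close>

lemma monic_root_factor:
  fixes p :: "real poly" and z :: complex
  assumes p: "lead_coeff p = 1" and z: "rpoly p z = 0"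
  obtains (real) q where "lead_coeff q = 1" "p = [:- Re z, 1:] * q" "Im z = 0"
  | (nonreal) q where "lead_coeff q = 1" "p = quad_poly z * q"
proof (cases "Im z = 0")
  case True
  then have "z = of_real (Re z)" by (simp add: complex_eq_iff)
  then have "rpoly p (of_real (Re z) :: complex) = 0" using z by simp
  moreover have "rpoly p (of_real r) = (of_real (poly p r) :: complex)" for r
    by (induction p) (simp_all add: rpoly_pCons)
  ultimately have "poly p (Re z) = 0" by simp
  then obtain q where q: "p = [:- Re z, 1:] * q" by (auto simp: poly_eq_0_iff_dvd elim: dvdE)
  then have "lead_coeff q = 1" using p by (simp only: lead_coeff_mult) simp
  then show ?thesis using q True by (rule real)
next
  case False
  define r where "r = p mod quad_poly z"
  have pq: "p = quad_poly z * (p div quad_poly z) + r" by (simp add: r_def)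
  have rz: "rpoly r z = 0"
    using z rpoly_quad_root[of z] by (subst (asm) pq) (simp add: rpoly_add rpoly_mult)
  have "quad_poly z \<noteq> 0" by (simp add: quad_poly_def)
  then have deg: "r = 0 \<or> degree r < 2"
    using degree_mod_less[of "quad_poly z" p] by (simp add: r_def)
  then obtain a b where r: "r = [:a, b:]"
    by (metis degree_pCons_eq_if degree_eq_zeroE less_2_cases_iff numeral_2_eq_2 old.nat.inject pCons_0_0 pCons_cases)
  have "r = 0" using rz False by (auto simp: r rpoly_pCons complex_eq_iff)
  then have q: "p = quad_poly z * (p div quad_poly z)" using pq by simp
  then have "lead_coeff (p div quad_poly z) = 1"
    using p degree_quad(2)[of z] by (metis lead_coeff_mult mult_1)
  then show ?thesis using q by (rule nonreal)
qed

text \<open>Squaring the norm treats both kinds of factors alike. A real linear factor contributes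
  exactly the norm of the quadratic; a nonreal pair contributes its square, of which one copy is
  kept and the other bounded below by \<open>m\<close>. So each degree costs one \<open>m\<close>,
  except that the chosen root keeps its exact value.\<close>

lemma norm_rpoly_ge_aux:
  fixes x :: "'k::real_normed_field"
  assumes m: "0 \<le> m" "\<And>z. m \<le> norm (rpoly (quad_poly z) x)"
    and p: "lead_coeff p = 1" and z: "rpoly p z = 0"
    and IH: "\<And>q. lead_coeff q = 1 \<Longrightarrow> degree q < degree p \<Longrightarrow> m ^ degree q \<le> (norm (rpoly q x))\<^sup>2"
  shows "norm (rpoly (quad_poly z) x) * m ^ (degree p - 1) \<le> (norm (rpoly p x))\<^sup>2"
proof (rule monic_root_factor[OF p z])
  fix q assume real: "lead_coeff q = 1" "p = [:- Re z, 1:] * q" "Im z = 0"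
  have "q \<noteq> 0" using real by auto
  then have deg: "degree p = Suc (degree q)" unfolding real(2) by (subst degree_mult_eq) auto
  have "(norm (rpoly p x))\<^sup>2 = norm (rpoly (quad_poly z) x) * (norm (rpoly q x))\<^sup>2"
    unfolding real(2) rpoly_mult using real(3)
    by (simp add: rpoly_quad rpoly_pCons norm_mult norm_power power_mult_distrib)
  then show ?thesis using IH[of q] real deg by (simp add: mult_left_mono)
next
  fix q assume nonreal: "lead_coeff q = 1" "p = quad_poly z * q"
  let ?f = "norm (rpoly (quad_poly z) x)"
  have "q \<noteq> 0" "quad_poly z \<noteq> 0" using nonreal by (auto simp: quad_poly_def)
  then have deg: "degree p = Suc (Suc (degree q))" unfolding nonreal(2) by (subst degree_mult_eq) auto
  have "?f * m ^ (degree p - 1) = ?f * (m * m ^ degree q)" by (simp add: deg)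
  also have "\<dots> \<le> ?f * (?f * (norm (rpoly q x))\<^sup>2)"
    using IH[of q] nonreal(1) deg m by (intro mult_mono mult_left_mono) auto
  also have "\<dots> = (norm (rpoly p x))\<^sup>2"
    unfolding nonreal(2) by (simp add: rpoly_mult norm_mult power_mult_distrib power2_eq_square)
  finally show ?thesis .
qed

lemma monic_rpoly_root:
  assumes "degree p > 0" obtains z :: complex where "rpoly p z = 0"
proof -
  have "degree (map_poly complex_of_real p) = degree p" by (rule degree_map_poly) simp
  then have "\<not> constant (poly (map_poly complex_of_real p))"
    using assms constant_degree[of "map_poly complex_of_real p"] by simp
  then show ?thesis using fundamental_theorem_of_algebra that unfolding rpoly_def by blast
qed

lemma norm_rpoly_ge:
  fixes x :: "'k::real_normed_field"
  assumes m: "0 \<le> m" "\<And>z. m \<le> norm (rpoly (quad_poly z) x)" and p: "lead_coeff p = 1"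
  shows "m ^ degree p \<le> (norm (rpoly p x))\<^sup>2"
  using p
proof (induction "degree p" arbitrary: p rule: less_induct)
  case less
  show ?case
  proof (cases "degree p = 0")
    case True
    then have "p = 1" using less.prems by (metis degree_eq_zeroE lead_coeff_pCons(2) one_pCons)
    then show ?thesis by simp
  next
    case False
    then obtain z :: complex where z: "rpoly p z = 0" using monic_rpoly_root by auto
    have "m ^ degree p = m * m ^ (degree p - 1)" using False by (simp add: power_eq_if)
    also have "\<dots> \<le> norm (rpoly (quad_poly z) x) * m ^ (degree p - 1)"
      using m by (intro mult_right_mono) auto
    also have "\<dots> \<le> (norm (rpoly p x))\<^sup>2"
      using norm_rpoly_ge_aux[OF m less.prems z] less.hyps by blast
    finally show ?thesis .
  qed
qed

text \<open>Keeping the exact value at one root, instead of weakening it to \<open>m\<close>, is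
  what later bounds that value from above.\<close>

lemma norm_rpoly_ge_root:
  fixes x :: "'k::real_normed_field"
  assumes m: "0 \<le> m" "\<And>z. m \<le> norm (rpoly (quad_poly z) x)"
    and p: "lead_coeff p = 1" and z: "rpoly p z = 0"
  shows "norm (rpoly (quad_poly z) x) * m ^ (degree p - 1) \<le> (norm (rpoly p x))\<^sup>2"
  using norm_rpoly_ge_aux[OF m p z] norm_rpoly_ge[OF m] by blast

text \<open>The function grows like the square of \<open>cmod z\<close>, so compactness of a ball
  gives a minimum. The minimisers again form a compact set, and one of largest modulus makes the
  inequality strict beyond it.\<close>

lemma norm_rpoly_quad_min:
  fixes x :: "'k::real_normed_field"
  obtains z0 where "\<And>z. norm (rpoly (quad_poly z0) x) \<le> norm (rpoly (quad_poly z) x)"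
    "\<And>z. cmod z0 < cmod z \<Longrightarrow> norm (rpoly (quad_poly z0) x) < norm (rpoly (quad_poly z) x)"
proof -
  define f where "f z = norm (rpoly (quad_poly z) x)" for z
  define N where "N = norm x + 1"
  have N: "N \<ge> 1" "norm x < N" by (auto simp: N_def)
  have cont: "continuous_on S f" for S
    unfolding f_def rpoly_quad by (intro continuous_intros)
  have far: "f 0 < f z" if "cmod z > 4 * N" for z
  proof -
    let ?R = "cmod z"
    have eq: "of_real (?R\<^sup>2) = rpoly (quad_poly z) x - x\<^sup>2 + of_real (2 * Re z) * x"
      by (simp add: quad_poly_def rpoly_pCons power2_eq_square algebra_simps)
    have "?R\<^sup>2 \<le> norm (rpoly (quad_poly z) x - x\<^sup>2) + norm (of_real (2 * Re z) * x)"
      using norm_triangle_ineq[of "rpoly (quad_poly z) x - x\<^sup>2" "of_real (2 * Re z) * x"]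
      unfolding eq[symmetric] norm_of_real by simp
    also have "norm (rpoly (quad_poly z) x - x\<^sup>2) \<le> f z + (norm x)\<^sup>2"
      unfolding f_def using norm_triangle_ineq4[of "rpoly (quad_poly z) x" "x\<^sup>2"] by (simp add: norm_power)
    also have "norm (of_real (2 * Re z) * x) \<le> 2 * ?R * N"
      using abs_Re_le_cmod[of z] N by (auto simp: norm_mult intro!: mult_mono)
    finally have "?R\<^sup>2 - 2 * ?R * N - (norm x)\<^sup>2 \<le> f z" by simp
    moreover have "(norm x)\<^sup>2 \<le> N\<^sup>2" using N by (intro power_mono) auto
    \<comment> \<open>Beyond radius \<open>4 * N\<close> this gives
      \<open>f z \<ge> 7 * N\<^sup>2\<close>, whereas \<open>f 0 \<le> N\<^sup>2\<close>.\<close>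
    moreover have "4 * N * (2 * N) \<le> ?R * (?R - 2 * N)"
      using that N by (intro mult_mono) auto
    moreover have "0 < N\<^sup>2" using N by simp
    moreover have "f 0 = (norm x)\<^sup>2" by (simp add: f_def rpoly_quad norm_power)
    ultimately show ?thesis by (simp add: power2_eq_square algebra_simps)
  qed
  have "\<exists>z\<in>cball 0 (4 * N). \<forall>w\<in>cball 0 (4 * N). f z \<le> f w"
    using N by (intro continuous_attains_inf cont) auto
  then obtain y where y: "y \<in> cball 0 (4*N)" "\<And>w. w \<in> cball 0 (4*N) \<Longrightarrow> f y \<le> f w" by blast
  have ymin: "f y \<le> f w" for w
  proof (cases "w \<in> cball 0 (4 * N)")
    case False
    then have "f 0 < f w" by (intro far) auto
    then show ?thesis using y(2)[of 0] N by simp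
  qed (rule y(2))
  define S where "S = {z \<in> cball 0 (4 * N). f z \<le> f y}"
  have "closed S" unfolding S_def
    by (intro continuous_on_closed_Collect_le cont continuous_on_const) auto
  moreover have "bounded S"
    by (rule bounded_subset[OF bounded_cball, of _ 0 "4 * N"]) (auto simp: S_def)
  ultimately have "compact S" by (simp add: compact_eq_bounded_closed)
  moreover have "S \<noteq> {}" using y by (auto simp: S_def)
  ultimately have "\<exists>z\<in>S. \<forall>w\<in>S. cmod w \<le> cmod z"
    by (intro continuous_attains_sup continuous_intros)
  then obtain z0 where z0: "z0 \<in> S" "\<And>w. w \<in> S \<Longrightarrow> cmod w \<le> cmod z0" by blast
  have eq: "f z0 = f y" using z0(1) ymin[of z0] by (auto simp: S_def)
  show ?thesis
  proof (rule that[of z0, folded f_def])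
    show "f z0 \<le> f z" for z using ymin eq by simp
    show "f z0 < f z" if "cmod z0 < cmod z" for z
    proof (cases "z \<in> S")
      case True
      then show ?thesis using z0(2)[OF True] that by simp
    next
      case False
      then show ?thesis using ymin[of z] far[of z] y(2)[of 0] N eq by (auto simp: S_def not_le)
    qed
  qed
qed

text \<open>Let \<open>z0\<close> minimise \<open>norm (rpoly (quad_poly z) x)\<close>, with \<open>cmod z0\<close> largest, and suppose that the
  minimum \<open>m\<close> is positive.  Perturb \<open>quad_poly z0\<close> to \<open>quad_poly z1 = quad_poly z0 + m/2\<close>, so that
  \<open>z1\<close> is a root of \<open>p = quad_poly z0 ^ n - (- m/2) ^ n\<close>.  Splitting \<open>p\<close> into real quadratic factors
  bounds the value at \<open>z1\<close> by \<open>m (1 + 2 powr - n)^2\<close>; letting \<open>n\<close> tend to infinity contradicts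
  the maximality of \<open>cmod z0\<close>.\<close>

lemma real_normed_field_quadratic:
  fixes x :: "'k::real_normed_field"
  obtains s r where "(x - of_real s)\<^sup>2 + of_real (r\<^sup>2) = 0"
proof -
  obtain z0 where min: "\<And>z. norm (rpoly (quad_poly z0) x) \<le> norm (rpoly (quad_poly z) x)"
    and strict: "\<And>z. cmod z0 < cmod z \<Longrightarrow> norm (rpoly (quad_poly z0) x) < norm (rpoly (quad_poly z) x)"
    by (rule norm_rpoly_quad_min[of x]) auto
  define m where "m = norm (rpoly (quad_poly z0) x)"
  have "m = 0"
  proof (rule ccontr)
    assume "m \<noteq> 0"
    then have m: "m > 0" by (simp add: m_def)
    \<comment> \<open>Any shift strictly between 0 and \<open>m\<close> would serve: being positive
      it increases the modulus, and being below \<open>m\<close> it makes its \<open>n\<close>-th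
      power negligible against \<open>m ^ n\<close>.\<close>
    define z1 where "z1 = Complex (Re z0) (sqrt ((Im z0)\<^sup>2 + m/2))"
    let ?f1 = "norm (rpoly (quad_poly z1) x)"
    have sq: "(cmod z1)\<^sup>2 = (cmod z0)\<^sup>2 + m/2"
      using m by (simp add: cmod_power2 z1_def)
    have "Re z1 = Re z0" by (simp add: z1_def)
    have "cmod z0 < cmod z1"
      by (rule power2_less_imp_less) (use sq m in auto)
    then have f1: "m < ?f1" using strict by (simp add: m_def)
    have quad_z1: "rpoly (quad_poly z0) z1 = - of_real (m/2)"
    proof -
      have "quad_poly z0 = quad_poly z1 - [:m/2:]"
        using \<open>Re z1 = Re z0\<close> by (simp add: quad_poly_def sq)
      then show ?thesis by (simp add: rpoly_diff rpoly_const rpoly_quad_root)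
    qed
    have bound: "?f1 / m \<le> (1 + (1/2) ^ n)\<^sup>2" if n: "n > 0" for n :: nat
    proof -
      define p where "p = quad_poly z0 ^ n - [:(- (m/2)) ^ n:]"
      have degq: "degree (quad_poly z0 ^ n) = 2 * n"
        using degree_quad[of z0] by (metis degree_power_eq leading_coeff_0_iff mult.commute zero_neq_one)
      have deg: "degree p = 2 * n"
      proof -
        have "degree [:(- (m/2)) ^ n:] < degree (quad_poly z0 ^ n)"
          using n by (simp add: degq)
        then show ?thesis unfolding p_def degq[symmetric]
          using degree_add_eq_left[of "- [:(- (m/2)) ^ n:]" "quad_poly z0 ^ n"]
          by (simp only: degree_minus diff_conv_add_uminus)
      qed
      have "lead_coeff p = lead_coeff (quad_poly z0 ^ n)"
        unfolding deg unfolding p_def degq using n by (simp add: coeff_pCons split: nat.split)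
      then have lc: "lead_coeff p = 1" by (simp only: lead_coeff_power degree_quad(2) power_one)
      have "rpoly p z1 = 0"
        by (simp add: p_def rpoly_diff rpoly_power rpoly_const quad_z1)
      then have "?f1 * m ^ (2 * n - 1) \<le> (norm (rpoly p x))\<^sup>2"
        using norm_rpoly_ge_root[of m x p z1] min lc m unfolding deg m_def by simp
      also have "norm (rpoly p x) \<le> m ^ n + (m/2) ^ n"
        unfolding p_def rpoly_diff rpoly_power rpoly_const
        using norm_triangle_ineq4[of "rpoly (quad_poly z0) x ^ n" "of_real ((- (m/2)) ^ n)"] m
        by (simp add: norm_power m_def power_abs)
      then have "(norm (rpoly p x))\<^sup>2 \<le> (m ^ n + (m/2) ^ n)\<^sup>2" by (intro power_mono) auto
      also have "m ^ n + (m/2) ^ n = m ^ n * (1 + (1/2) ^ n)"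
        by (simp add: power_divide algebra_simps)
      finally have "?f1 * m ^ (2 * n - 1) \<le> m ^ (2 * n) * (1 + (1/2) ^ n)\<^sup>2"
        by (simp add: power_mult_distrib power_even_eq power_mult[symmetric] mult.commute)
      also have "m ^ (2 * n) = m * m ^ (2 * n - 1)" using n by (simp add: power_eq_if)
      finally have "?f1 \<le> m * (1 + (1/2) ^ n)\<^sup>2" using m by (simp add: mult.commute mult.left_commute)
      then show ?thesis using m by (simp add: field_simps)
    qed
    have "(\<lambda>n. (1 + (1/2) ^ n)\<^sup>2 :: real) \<longlonglongrightarrow> (1 + 0)\<^sup>2"
      by (intro tendsto_intros LIMSEQ_power_zero) simp
    then have "?f1 / m \<le> (1 + 0)\<^sup>2"
      by (rule LIMSEQ_le_const) (use bound in \<open>auto intro!: exI[of _ 1]\<close>)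
    then show False using f1 m by simp
  qed
  then show ?thesis
    using that[of "Re z0" "Im z0"] by (simp add: m_def rpoly_quad)
qed

text \<open>A nonreal element, normalised through its quadratic equation, yields \<open>i\<close>.
  The quadratic equation of any other \<open>y\<close> then splits into linear factors over
  \<open>i\<close>, one of which must vanish.\<close>

theorem real_normed_field_cases:
  obtains (real) "\<And>x::'k::real_normed_field. x \<in> range of_real"
  | (complex) i :: "'k::real_normed_field" where "i * i = - 1" "\<And>x. \<exists>a b. x = of_real a + of_real b * i"
proof (cases "\<forall>x::'k. x \<in> range of_real")
  case True
  then show ?thesis using real by blast
next
  case False
  then obtain x :: 'k where x: "x \<notin> range of_real" by blast
  obtain s r where sr: "(x - of_real s)\<^sup>2 + of_real (r\<^sup>2) = 0"
    by (rule real_normed_field_quadratic)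
  have r: "r \<noteq> 0" using sr x by auto
  define i where "i = (x - of_real s) / of_real r"
  have i: "i * i = - 1"
    using sr r by (simp add: i_def power2_eq_square field_simps add_eq_0_iff)
  have "\<exists>a b. y = of_real a + of_real b * i" for y
  proof -
    obtain s r where "(y - of_real s)\<^sup>2 + of_real (r\<^sup>2) = 0"
      by (rule real_normed_field_quadratic)
    moreover have "(y - (of_real s + of_real r * i)) * (y - (of_real s + of_real (- r) * i))
        = (y - of_real s)\<^sup>2 - of_real (r\<^sup>2) * (i * i)"
      by (simp add: power2_eq_square algebra_simps)
    ultimately have "(y - (of_real s + of_real r * i)) * (y - (of_real s + of_real (- r) * i)) = 0"
      using i by simp
    then have "y = of_real s + of_real r * i \<or> y = of_real s + of_real (- r) * i"
      unfolding mult_eq_0_iff right_minus_eq .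
    then show ?thesis by blast
  qed
  then show ?thesis using i complex by blast
qed

section \<open>Functionals over the scalar field\<close>

definition F_subspace :: "('k::real_normed_field \<Rightarrow> 'a::real_normed_vector \<Rightarrow> 'a) \<Rightarrow> 'a set \<Rightarrow> bool" where
  "F_subspace smul M \<longleftrightarrow>
     0 \<in> M \<and> (\<forall>x\<in>M. \<forall>y\<in>M. x + y \<in> M) \<and> (\<forall>c. \<forall>x\<in>M. smul c x \<in> M)"

lemma
  assumes "F_normed_space smul"
  shows F_smul_smul: "smul c (smul d x) = smul (c * d) x"
    and F_smul_one: "smul 1 x = x"
    and F_smul_add_right: "smul c (x + y) = smul c x + smul c y"
    and F_smul_add_left: "smul (c + d) x = smul c x + smul d x"
    and F_norm_smul: "norm (smul c x) = norm c * norm x"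
    and F_smul_of_real: "smul (of_real r) x = r *\<^sub>R x"
  using assms unfolding F_normed_space_def by auto

lemma F_smul_zero: assumes "F_normed_space smul" shows "smul 0 x = 0" "smul c 0 = 0"
  using F_norm_smul[OF assms, of 0 x] F_norm_smul[OF assms, of c 0] by simp_all

lemma F_smul_minus_one: assumes "F_normed_space smul" shows "smul (- 1) x = - x"
  using F_smul_of_real[OF assms, of "-1" x] by simp

lemma F_subspace_subspace:
  assumes "F_normed_space smul" "F_subspace smul M" shows "subspace M"
  using assms(2) unfolding F_subspace_def subspace_def by (metis F_smul_of_real[OF assms(1)])

lemma bounded_linear_smul_left:
  assumes "F_normed_space smul" shows "bounded_linear (\<lambda>c. smul c v)"
proof (rule bounded_linear_intro[where K = "norm v"])
  show "smul (r *\<^sub>R c) v = r *\<^sub>R smul c v" for r c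
    by (simp add: scaleR_conv_of_real F_smul_of_real[OF assms, symmetric] F_smul_smul[OF assms])
qed (simp_all add: F_smul_add_left[OF assms] F_norm_smul[OF assms])

lemma
  assumes "F_functional smul f"
  shows F_functional_bounded_linear: "bounded_linear f"
    and F_functional_smul: "f (smul c x) = c * f x"
  using assms by (auto simp: F_functional_def)

lemma F_functional_scale:
  assumes "F_functional smul f" shows "F_functional smul (\<lambda>x. d * f x)"
  using assms unfolding F_functional_def
  by (auto intro!: bounded_linear_const_mult simp: mult.left_commute)

text \<open>Multiply by the conjugate: the product has norm \<open>a\<^sup>2 + b\<^sup>2\<close>, at
  least half the square of \<open>\<bar>a\<bar> + \<bar>b\<bar>\<close>, and the conjugate has norm
  at most \<open>\<bar>a\<bar> + \<bar>b\<bar>\<close>. This avoids identifying the norm with the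
  usual modulus.\<close>

lemma norm_complex_lower:
  fixes i :: "'k::real_normed_field"
  assumes i: "i * i = - 1"
  shows "norm i = 1" and "\<bar>a\<bar> / 2 \<le> norm (of_real a - of_real b * i)"
proof -
  have "norm i * norm i = 1" using i by (metis norm_mult norm_minus_cancel norm_one)
  then show ni: "norm i = 1" by (metis abs_norm_cancel abs_square_eq_1 power2_eq_square)
  let ?s = "\<bar>a\<bar> + \<bar>b\<bar>"
  have "(of_real a - of_real b * i) * (of_real a + of_real b * i) = of_real (a\<^sup>2 + b\<^sup>2)"
    using i by (simp add: power2_eq_square algebra_simps) (simp add: mult.assoc[symmetric])
  then have "norm (of_real a - of_real b * i) * norm (of_real a + of_real b * i) = a\<^sup>2 + b\<^sup>2"
    by (metis norm_mult norm_of_real abs_of_nonneg sum_power2_ge_zero)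
  moreover have "norm (of_real a + of_real b * i) \<le> ?s"
    using norm_triangle_ineq[of "of_real a" "of_real b * i"] ni by (simp add: norm_mult)
  ultimately have "a\<^sup>2 + b\<^sup>2 \<le> norm (of_real a - of_real b * i) * ?s"
    by (metis mult_left_mono norm_ge_zero)
  moreover have "?s / 2 * ?s \<le> a\<^sup>2 + b\<^sup>2"
    using sum_squares_ge_zero[of "\<bar>a\<bar> - \<bar>b\<bar>" 0] by (simp add: power2_eq_square algebra_simps)
  ultimately have *: "?s / 2 * ?s \<le> norm (of_real a - of_real b * i) * ?s" by linarith
  have "?s / 2 \<le> norm (of_real a - of_real b * i)"
  proof (cases "?s = 0")
    case False
    then have "0 < ?s" by linarith
    then show ?thesis using * by (rule mult_right_le_imp_le[rotated])
  qed (metis div_0 norm_ge_zero)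
  moreover have "\<bar>a\<bar> / 2 \<le> ?s / 2" by simp
  ultimately show "\<bar>a\<bar> / 2 \<le> norm (of_real a - of_real b * i)" by (rule order_trans[rotated])
qed

text \<open>In the complex case this is the usual passage from \<open>u\<close> to
  \<open>u x - i u (i x)\<close>, which is complex linear with real part \<open>u\<close>. The
  factor 2 in the upper bound is the triangle inequality, the 2 in the lower one comes from
  \<open>norm_complex_lower\<close>.\<close>

theorem Hahn_Banach_F_functional:
  fixes smul :: "'k::real_normed_field \<Rightarrow> 'a::real_normed_vector \<Rightarrow> 'a"
  assumes A: "F_normed_space smul" and M: "F_subspace smul M"
  obtains f where "F_functional smul f" "\<And>x. norm (f x) \<le> 2 * norm x"
    "\<And>x. x \<in> M \<Longrightarrow> f x = 0" "infdist v M / 2 \<le> norm (f v)"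
proof -
  have sub: "subspace M" by (rule F_subspace_subspace[OF A M])
  obtain u where u: "linear u" "\<And>x. \<bar>u x\<bar> \<le> infdist x M" "u v = infdist v M"
    by (rule Hahn_Banach_infdist[OF sub, of v]) auto
  have u_le: "\<bar>u x\<bar> \<le> norm x" for x
    using u(2)[of x] infdist_subspace_le_norm[OF sub, of x] by linarith
  have u0: "u x = 0" if "x \<in> M" for x using u(2)[of x] that by simp
  note u_add = linear_add[OF u(1)] and u_scale = linear_scale[OF u(1)]
  show ?thesis
  proof (cases rule: real_normed_field_cases[where 'k = 'k])
    case real
    have smul: "of_real (u (smul c x)) = c * of_real (u x)" for c :: 'k and x
    proof -
      obtain r where "c = of_real r" using real[of c] by blast
      then show ?thesis by (simp add: F_smul_of_real[OF A] u_scale)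
    qed
    have "bounded_linear (\<lambda>x. of_real (u x) :: 'k)"
      by (rule bounded_linear_intro[where K = 1])
        (use u_le in \<open>simp_all add: u_add u_scale scaleR_conv_of_real\<close>)
    then show ?thesis
      using u_le u0 u(3) infdist_nonneg[of v M] smul order_trans[OF u_le]
      by (intro that[of "\<lambda>x. of_real (u x)"]) (auto simp: F_functional_def)
  next
    case (complex i)
    note i = norm_complex_lower[OF complex(1)]
    define f where "f x = of_real (u x) - of_real (u (smul i x)) * i" for x
    have ii: "smul i (smul i x) = - x" for x
      by (simp add: F_smul_smul[OF A] complex(1) F_smul_minus_one[OF A])
    have add: "f (x + y) = f x + f y" for x y
      by (simp add: f_def F_smul_add_right[OF A] u_add algebra_simps)
    have scale: "f (r *\<^sub>R x) = of_real r * f x" for r x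
    proof -
      have "smul i (r *\<^sub>R x) = r *\<^sub>R smul i x"
        by (simp add: F_smul_of_real[OF A, symmetric] F_smul_smul[OF A] mult.commute)
      then show ?thesis by (simp add: f_def u_scale algebra_simps)
    qed
    have smul_i: "f (smul i x) = i * f x" for x
    proof -
      have "i * f x = of_real (u x) * i - of_real (u (smul i x)) * (i * i)"
        by (simp add: f_def algebra_simps)
      then show ?thesis using complex(1) by (simp add: f_def ii linear_neg[OF u(1)])
    qed
    have smul: "f (smul c x) = c * f x" for c x
    proof -
      obtain a b where c: "c = of_real a + of_real b * i" using complex(2) by blast
      have "smul c x = a *\<^sub>R x + b *\<^sub>R smul i x"
        by (simp add: c F_smul_add_left[OF A] F_smul_of_real[OF A, symmetric] F_smul_smul[OF A])
      then show ?thesis by (simp add: add scale smul_i c algebra_simps)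
    qed
    have le: "norm (f x) \<le> 2 * norm x" for x
    proof -
      have "norm (f x) \<le> \<bar>u x\<bar> + \<bar>u (smul i x)\<bar>"
        using norm_triangle_ineq4[of "of_real (u x)" "of_real (u (smul i x)) * i"] i(1)
        by (simp add: f_def norm_mult)
      also have "\<dots> \<le> norm x + norm (smul i x)" by (intro add_mono u_le)
      finally show ?thesis by (simp add: F_norm_smul[OF A] i(1))
    qed
    have "bounded_linear f"
      by (rule bounded_linear_intro[where K = 2])
        (use le in \<open>simp_all add: add scale scaleR_conv_of_real mult.commute\<close>)
    then have "F_functional smul f" using smul by (simp add: F_functional_def)
    moreover have "f x = 0" if "x \<in> M" for x
      using u0[OF that] u0[of "smul i x"] M that by (simp add: f_def F_subspace_def)
    moreover have "infdist v M / 2 \<le> norm (f v)"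
      using i(2)[of "u v" "u (smul i v)"] u(3) infdist_nonneg[of v M] by (simp add: f_def)
    ultimately show ?thesis using le by (intro that)
  qed
qed

corollary exists_dual_functional:
  fixes smul :: "'k::real_normed_field \<Rightarrow> 'a::real_normed_vector \<Rightarrow> 'a"
  assumes A: "F_normed_space smul" and M: "F_subspace smul M" and "closed M" "v \<notin> M"
  obtains f where "F_functional smul f" "\<And>x. x \<in> M \<Longrightarrow> f x = 0" "f v = 1"
proof -
  obtain f where f: "F_functional smul f" "\<And>x. x \<in> M \<Longrightarrow> f x = 0" "infdist v M / 2 \<le> norm (f v)"
    by (rule Hahn_Banach_F_functional[OF A M, of v]) auto
  have "M \<noteq> {}" using M by (auto simp: F_subspace_def)
  then have "0 < infdist v M" using assms infdist_pos_not_in_closed by blast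
  then have "f v \<noteq> 0" using f(3) by auto
  then show ?thesis
    using f by (intro that[of "\<lambda>x. inverse (f v) * f x"] F_functional_scale) auto
qed

corollary exists_norming_functional:
  fixes smul :: "'k::real_normed_field \<Rightarrow> 'a::real_normed_vector \<Rightarrow> 'a"
  assumes A: "F_normed_space smul"
  obtains f where "F_functional smul f" "onorm f \<le> 2" "norm v / 2 \<le> norm (f v)"
proof -
  have "F_subspace smul {0}" by (simp add: F_subspace_def F_smul_zero[OF A])
  then obtain f where "F_functional smul f" "\<And>x. norm (f x) \<le> 2 * norm x" "infdist v {0} / 2 \<le> norm (f v)"
    by (rule Hahn_Banach_F_functional[OF A, of _ v]) auto
  then show ?thesis by (intro that[of f] onorm_bound) auto
qed

section \<open>Finite spans over the scalar field\<close>

lemma F_span_sum_mem: "(\<Sum>v\<in>S. smul (c v) v) \<in> F_span smul S"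
  unfolding F_span_def by blast

lemma F_span_insert:
  assumes A: "F_normed_space smul" and S: "finite S" "v \<notin> S"
  shows "F_span smul (insert v S) = {m + smul c v | m c. m \<in> F_span smul S}"
proof (intro equalityI subsetI)
  fix x assume "x \<in> F_span smul (insert v S)"
  then obtain c where "x = (\<Sum>w\<in>insert v S. smul (c w) w)" by (auto simp: F_span_def)
  then have "x = (\<Sum>w\<in>S. smul (c w) w) + smul (c v) v" using S by (simp add: add.commute)
  then show "x \<in> {m + smul c v | m c. m \<in> F_span smul S}" by (auto simp: F_span_def)
next
  fix x assume "x \<in> {m + smul c v | m c. m \<in> F_span smul S}"
  then obtain c d where x: "x = (\<Sum>w\<in>S. smul (c w) w) + smul d v" by (auto simp: F_span_def)
  have "(\<Sum>w\<in>S. smul ((c(v := d)) w) w) = (\<Sum>w\<in>S. smul (c w) w)"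
    using S(2) by (intro sum.cong) auto
  then have "x = (\<Sum>w\<in>insert v S. smul ((c(v := d)) w) w)"
    using S x by (simp add: add.commute)
  then show "x \<in> F_span smul (insert v S)" by (simp only: F_span_sum_mem)
qed

lemma F_subspace_F_span:
  assumes A: "F_normed_space smul" shows "F_subspace smul (F_span smul S)"
proof -
  have "0 \<in> F_span smul S"
    using F_span_sum_mem[of smul "\<lambda>_. 0" S] by (simp add: F_smul_zero[OF A])
  moreover have "x + y \<in> F_span smul S" if "x \<in> F_span smul S" "y \<in> F_span smul S" for x y
  proof -
    obtain c d where "x = (\<Sum>w\<in>S. smul (c w) w)" "y = (\<Sum>w\<in>S. smul (d w) w)"
      using \<open>x \<in> _\<close> \<open>y \<in> _\<close> by (auto simp: F_span_def)
    then have "x + y = (\<Sum>w\<in>S. smul (c w + d w) w)"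
      by (simp add: F_smul_add_left[OF A] sum.distrib)
    then show ?thesis by (simp only: F_span_sum_mem[of smul "\<lambda>w. c w + d w"])
  qed
  moreover have "smul d x \<in> F_span smul S" if x: "x \<in> F_span smul S" for d x
  proof -
    obtain c where "x = (\<Sum>w\<in>S. smul (c w) w)" using x by (auto simp: F_span_def)
    moreover have "smul d (sum g S) = (\<Sum>w\<in>S. smul d (g w))" for g
      by (induction S rule: infinite_finite_induct)
        (simp_all add: F_smul_zero[OF A] F_smul_add_right[OF A])
    ultimately have "smul d x = (\<Sum>w\<in>S. smul (d * c w) w)"
      by (simp add: F_smul_smul[OF A])
    then show ?thesis by (simp only: F_span_sum_mem[of smul "\<lambda>w. d * c w"])
  qed
  ultimately show ?thesis by (simp add: F_subspace_def)
qed

section \<open>Closedness of finite-rank tensor subspaces\<close>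

locale reasonable_crossnorm =
  fixes smulA :: "'k::real_normed_field \<Rightarrow> 'a::banach \<Rightarrow> 'a"
    and smulB :: "'k \<Rightarrow> 'b::banach \<Rightarrow> 'b"
    and smulX :: "'k \<Rightarrow> 'x::banach \<Rightarrow> 'x"
    and t :: "'a \<Rightarrow> 'b \<Rightarrow> 'x"
  assumes A: "F_normed_space smulA"
    and B: "F_normed_space smulB"
    and X: "F_normed_space smulX"
    and t_add1: "\<And>a a' b. t (a + a') b = t a b + t a' b"
    and t_add2: "\<And>a b b'. t a (b + b') = t a b + t a b'"
    and t_smul1: "\<And>c a b. t (smulA c a) b = smulX c (t a b)"
    and t_smul2: "\<And>c a b. t a (smulB c b) = smulX c (t a b)"
    and crossnorm: "\<And>a b. norm (t a b) = norm a * norm b"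
    and dual_crossnorm: "\<And>f g. F_functional smulA f \<Longrightarrow> F_functional smulB g \<Longrightarrow>
          \<exists>h. F_functional smulX h \<and> (\<forall>a b. h (t a b) = f a * g b) \<and>
              onorm h = onorm f * onorm g"
begin

lemma t_zero: "t 0 b = 0" "t a 0 = 0"
  using crossnorm[of 0 b] crossnorm[of a 0] by simp_all

lemma t_scaleR2: "t a (r *\<^sub>R b) = r *\<^sub>R t a b"
  using t_smul2[of a "of_real r" b] by (simp add: F_smul_of_real[OF B] F_smul_of_real[OF X])

lemma t_diff1: "t (a - a') b = t a b - t a' b"
  using t_add1[of "a - a'" a' b] by simp

lemma t_diff2: "t a (b - b') = t a b - t a b'"
  using t_add2[of a "b - b'" b'] by simp

text \<open>Since the second factor ranges over all of \<open>'b\<close>, coefficients are absorbed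
  there, and the finite sums already form a real subspace.\<close>

lemma tspan_eq_span: "tspan t S UNIV = span {t a b | a b. a \<in> S}"
proof (intro equalityI subsetI)
  fix x assume "x \<in> tspan t S UNIV"
  then obtain n a b where "x = (\<Sum>i<n. t (a i) (b i))" "\<forall>i<(n::nat). a i \<in> S"
    by (auto simp: tspan_def)
  moreover have "t (a i) (b i) \<in> span {t a b | a b. a \<in> S}" if "a i \<in> S" for i
    by (rule span_base) (use that in blast)
  ultimately show "x \<in> span {t a b | a b. a \<in> S}" by (auto intro: span_sum)
next
  fix x assume "x \<in> span {t a b | a b. a \<in> S}"
  then show "x \<in> tspan t S UNIV"
  proof (induction rule: span_induct_alt)
    case base
    have "0 = (\<Sum>i<(0::nat). t (undefined i) (undefined i))" by simp
    then show ?case unfolding tspan_def by blast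
  next
    case (step c x y)
    obtain a b where x: "x = t a b" "a \<in> S" using step by blast
    obtain n a' b' where y: "y = (\<Sum>i<n. t (a' i) (b' i))" "\<forall>i<(n::nat). a' i \<in> S"
      using step by (auto simp: tspan_def)
    let ?a = "a'(n := a)" and ?b = "b'(n := c *\<^sub>R b)"
    have "c *\<^sub>R x + y = (\<Sum>i<Suc n. t (?a i) (?b i))"
      by (simp add: x y t_scaleR2 add.commute)
    moreover have "\<forall>i<Suc n. ?a i \<in> S" using x y by (simp add: less_Suc_eq)
    ultimately show ?case unfolding tspan_def by blast
  qed
qed

lemma subspace_tspan: "subspace (tspan t S UNIV)"
  by (simp add: tspan_eq_span)

lemma tspan_mono: "S \<subseteq> S' \<Longrightarrow> tspan t S UNIV \<subseteq> tspan t S' UNIV"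
  unfolding tspan_eq_span by (rule span_mono) auto

lemma t_mem_tspan: "a \<in> S \<Longrightarrow> t a b \<in> tspan t S UNIV"
  unfolding tspan_eq_span by (rule span_base) auto

text \<open>The estimate is obtained by testing \<open>w + t v b\<close> against \<open>f \<otimes> g\<close>, where \<open>f\<close> vanishes
  on \<open>M\<close> with \<open>f v = 1\<close>, and \<open>g\<close> almost norms \<open>b\<close>.\<close>

lemma tensor_complement_bound:
  assumes M: "F_subspace smulA M" "closed M" and v: "v \<notin> M"
  obtains C where "\<And>w b. w \<in> tspan t M UNIV \<Longrightarrow> norm b \<le> C * norm (w + t v b)"
proof -
  obtain f where f: "F_functional smulA f" "\<And>x. x \<in> M \<Longrightarrow> f x = 0" "f v = 1"
    by (rule exists_dual_functional[OF A M v]) auto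
  \<comment> \<open>The factor 4 multiplies the two losses \<open>onorm g \<le> 2\<close> and
    \<open>norm b / 2\<close>. As \<open>f\<close> is fixed before \<open>w\<close> and
    \<open>b\<close>, the constant depends only on \<open>M\<close> and \<open>v\<close>.\<close>
  have "norm b \<le> 4 * onorm f * norm (w + t v b)" if w: "w \<in> tspan t M UNIV" for w b
  proof -
    obtain g where g: "F_functional smulB g" "onorm g \<le> 2" "norm b / 2 \<le> norm (g b)"
      by (rule exists_norming_functional[OF B, of b]) auto
    obtain h where h: "F_functional smulX h" "\<And>a b. h (t a b) = f a * g b"
        "onorm h = onorm f * onorm g"
      using dual_crossnorm[OF f(1) g(1)] by blast
    have bl: "bounded_linear h" by (rule F_functional_bounded_linear[OF h(1)])
    have "h w = 0"
      by (rule linear_eq_0_on_span[OF bounded_linear.linear[OF bl] _ w[unfolded tspan_eq_span]])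
        (auto simp: h(2) f(2))
    then have "h (w + t v b) = g b"
      by (simp add: linear_add[OF bounded_linear.linear[OF bl]] h(2) f(3))
    then have "norm (g b) \<le> onorm h * norm (w + t v b)"
      using onorm[OF bl, of "w + t v b"] by simp
    also have "\<dots> \<le> onorm f * 2 * norm (w + t v b)"
      unfolding h(3) using g(2) onorm_pos_le[OF F_functional_bounded_linear[OF f(1)]]
      by (intro mult_right_mono mult_left_mono) auto
    finally show ?thesis using g(3) by simp
  qed
  then show ?thesis by (rule that)
qed

text \<open>Scalars move across the tensor sign, \<open>t (smulA c v) b = t v (smulB c b)\<close>,
  so a new generator contributes just one copy of \<open>'b\<close>.\<close>

lemma tspan_adjoin:
  assumes M: "F_subspace smulA M"
  shows "tspan t {m + smulA c v | m c. m \<in> M} UNIV = {w + t v b | w b. w \<in> tspan t M UNIV}"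
    (is "tspan t ?N UNIV = ?R")
proof
  have "w + t v b \<in> tspan t ?N UNIV" if w: "w \<in> tspan t M UNIV" for w b
  proof -
    have "M \<subseteq> ?N"
    proof
      fix m assume "m \<in> M"
      then show "m \<in> ?N" using F_smul_zero(1)[OF A, of v] by (intro CollectI exI[of _ m] exI[of _ 0]) simp
    qed
    moreover have "v \<in> ?N"
      using M F_smul_one[OF A, of v] by (intro CollectI exI[of _ 0] exI[of _ 1]) (simp add: F_subspace_def)
    ultimately show ?thesis
      using w tspan_mono[of M ?N] t_mem_tspan[of v ?N b] by (auto intro!: subspace_add[OF subspace_tspan])
  qed
  then show "?R \<subseteq> tspan t ?N UNIV" by blast
  have "subspace ?R"
    unfolding subspace_def
  proof (intro conjI ballI allI)
    show "0 \<in> ?R"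
      using subspace_0[OF subspace_tspan] t_zero(2)[of v] by (intro CollectI exI[of _ 0]) simp
    fix x assume "x \<in> ?R"
    then obtain w b where x: "x = w + t v b" "w \<in> tspan t M UNIV" by blast
    show "c *\<^sub>R x \<in> ?R" for c
      using subspace_scale[OF subspace_tspan x(2), of c]
      by (intro CollectI exI[of _ "c *\<^sub>R w"] exI[of _ "c *\<^sub>R b"]) (simp add: x t_scaleR2 scaleR_add_right)
    fix y assume "y \<in> ?R"
    then obtain w' b' where y: "y = w' + t v b'" "w' \<in> tspan t M UNIV" by blast
    show "x + y \<in> ?R"
      using subspace_add[OF subspace_tspan x(2) y(2)]
      by (intro CollectI exI[of _ "w + w'"] exI[of _ "b + b'"]) (simp add: x y t_add2)
  qed
  moreover have "t (m + smulA c v) b \<in> ?R" if "m \<in> M" for m c b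
  proof -
    have "t (m + smulA c v) b = t m b + t v (smulB c b)"
      by (simp add: t_add1 t_smul1 t_smul2)
    then show ?thesis using t_mem_tspan[OF that] by blast
  qed
  then have "{t a b | a b. a \<in> ?N} \<subseteq> ?R" by blast
  ultimately show "tspan t ?N UNIV \<subseteq> ?R"
    unfolding tspan_eq_span[of ?N] by (intro span_minimal)
qed

text \<open>With \<open>f\<close> vanishing on \<open>M\<close> and \<open>f v = 1\<close>, the
  enlarged space is the preimage of \<open>M\<close> under the continuous map that subtracts the
  \<open>v\<close>-component.\<close>

lemma closed_adjoin:
  assumes M: "F_subspace smulA M" "closed M" and v: "v \<notin> M"
  shows "closed {m + smulA c v | m c. m \<in> M}"
proof -
  obtain f where f: "F_functional smulA f" "\<And>x. x \<in> M \<Longrightarrow> f x = 0" "f v = 1"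
    by (rule exists_dual_functional[OF A M v]) auto
  note bl = F_functional_bounded_linear[OF f(1)]
  have "f (m + smulA c v) = c" if "m \<in> M" for m c
    using that by (simp add: linear_add[OF bounded_linear.linear[OF bl]] f F_functional_smul[OF f(1)])
  then have "{m + smulA c v | m c. m \<in> M} \<subseteq> (\<lambda>x. x - smulA (f x) v) -` M" by auto
  moreover have "x \<in> {m + smulA c v | m c. m \<in> M}" if "x - smulA (f x) v \<in> M" for x
    using that by (intro CollectI exI[of _ "x - smulA (f x) v"] exI[of _ "f x"]) simp
  ultimately have eq: "{m + smulA c v | m c. m \<in> M} = (\<lambda>x. x - smulA (f x) v) -` M" by blast
  have "bounded_linear (\<lambda>x. smulA (f x) v)"
    using bounded_linear_compose[OF bounded_linear_smul_left[OF A] bl] .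
  then have "continuous_on UNIV (\<lambda>x. x - smulA (f x) v)"
    by (intro continuous_intros linear_continuous_on)
  then show ?thesis unfolding eq using M(2) by (simp add: continuous_on_closed_vimage)
qed

text \<open>By \<open>tensor_complement_bound\<close> the components \<open>b n\<close> of a
  convergent sequence are Cauchy. Completeness of \<open>'b\<close> gives their limit, and what
  remains converges inside the closed old space.\<close>

lemma closed_tspan_adjoin:
  assumes M: "F_subspace smulA M" "closed M" and v: "v \<notin> M" and T: "closed (tspan t M UNIV)"
  shows "closed (tspan t {m + smulA c v | m c. m \<in> M} UNIV)"
  unfolding tspan_adjoin[OF M(1)] closed_sequential_limits
proof (intro allI impI, elim conjE)
  fix x l assume x: "\<forall>n. x n \<in> {w + t v b | w b. w \<in> tspan t M UNIV}" and lim: "x \<longlonglongrightarrow> l"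
  have "\<forall>n. \<exists>w b. x n = w + t v b \<and> w \<in> tspan t M UNIV" using x by blast
  then obtain w b where xw: "\<And>n. x n = w n + t v (b n)" "\<And>n. w n \<in> tspan t M UNIV" by metis
  obtain C where C: "\<And>w b. w \<in> tspan t M UNIV \<Longrightarrow> norm b \<le> C * norm (w + t v b)"
    by (rule tensor_complement_bound[OF M v]) auto
  \<comment> \<open>Enlarging \<open>C\<close> to \<open>\<bar>C\<bar> + 1\<close> makes the
    constant positive, so that \<open>e\<close> may be divided by it.\<close>
  have b_le: "norm (b m - b n) \<le> (\<bar>C\<bar> + 1) * norm (x m - x n)" for m n
  proof -
    have "norm (b m - b n) \<le> C * norm ((w m - w n) + t v (b m - b n))"
      by (intro C subspace_diff[OF subspace_tspan] xw)
    also have "(w m - w n) + t v (b m - b n) = x m - x n" by (simp add: xw t_diff2)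
    also have "C * norm (x m - x n) \<le> (\<bar>C\<bar> + 1) * norm (x m - x n)" by (intro mult_right_mono) auto
    finally show ?thesis .
  qed
  have "Cauchy b"
  proof (rule metric_CauchyI)
    fix e :: real assume e: "0 < e"
    have "Cauchy x" using lim by (rule LIMSEQ_imp_Cauchy)
    then obtain N where N: "\<And>m n. m \<ge> N \<Longrightarrow> n \<ge> N \<Longrightarrow> dist (x m) (x n) < e / (\<bar>C\<bar> + 1)"
      using metric_CauchyD[of x "e / (\<bar>C\<bar> + 1)"] e by auto
    have "dist (b m) (b n) < e" if "m \<ge> N" "n \<ge> N" for m n
    proof -
      have "(\<bar>C\<bar> + 1) * dist (x m) (x n) < e" using N[OF that] by (simp add: field_simps)
      then show ?thesis using b_le[of m n] by (simp add: dist_norm)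
    qed
    then show "\<exists>N. \<forall>m\<ge>N. \<forall>n\<ge>N. dist (b m) (b n) < e" by blast
  qed
  then obtain b0 where b0: "b \<longlonglongrightarrow> b0" using convergent_eq_Cauchy by blast
  have "bounded_linear (t v)"
    by (rule bounded_linear_intro[where K = "norm v"])
      (simp_all add: t_add2 t_scaleR2 crossnorm mult.commute)
  then have "(\<lambda>n. t v (b n)) \<longlonglongrightarrow> t v b0" using b0 by (rule bounded_linear.tendsto)
  then have "(\<lambda>n. x n - t v (b n)) \<longlonglongrightarrow> l - t v b0" using lim by (intro tendsto_diff)
  moreover have "(\<lambda>n. x n - t v (b n)) = w" using xw(1) by auto
  ultimately have "l - t v b0 \<in> tspan t M UNIV"
    using closed_sequentially[OF T, of w] xw(2) by simp
  then show "l \<in> {w + t v b | w b. w \<in> tspan t M UNIV}"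
    by (intro CollectI exI[of _ "l - t v b0"] exI[of _ b0]) simp
qed

text \<open>Both claims go through one induction, because the functional separating a new generator
  from the old span needs that span to be closed.\<close>

lemma closed_F_span_tspan:
  assumes "finite S"
  shows "closed (F_span smulA S) \<and> closed (tspan t (F_span smulA S) UNIV)"
  using assms
proof (induction S)
  case empty
  have "F_span smulA {} = {0}" by (simp add: F_span_def)
  moreover have "tspan t {0} UNIV = {0}"
  proof -
    have "{t a b | a b. a \<in> {0}} = {0}" by (auto simp: t_zero)
    then show ?thesis by (simp add: tspan_eq_span)
  qed
  ultimately show ?case by simp
next
  case (insert v S)
  let ?M = "F_span smulA S"
  have eq: "F_span smulA (insert v S) = {m + smulA c v | m c. m \<in> ?M}"
    using F_span_insert[OF A insert.hyps] .
  have sub: "F_subspace smulA ?M" by (rule F_subspace_F_span[OF A])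
  show ?case
  proof (cases "v \<in> ?M")
    case True
    have "{m + smulA c v | m c. m \<in> ?M} = ?M"
    proof (intro equalityI subsetI)
      fix m assume "m \<in> ?M"
      then show "m \<in> {m + smulA c v | m c. m \<in> ?M}"
        using F_smul_zero(1)[OF A, of v] by (intro CollectI exI[of _ m] exI[of _ 0]) simp
    qed (use sub True in \<open>auto simp: F_subspace_def\<close>)
    then show ?thesis using insert.IH by (simp add: eq)
  next
    case False
    then show ?thesis
      unfolding eq using closed_adjoin[OF sub] closed_tspan_adjoin[OF sub] insert.IH by blast
  qed
qed

text \<open>Taking \<open>w = - t a b\<close> in the complement bound would force
  \<open>b = 0\<close>.\<close>

lemma t_notin_tspan:
  assumes "F_subspace smulA M" "closed M" "a \<notin> M" "b \<noteq> 0"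
  shows "t a b \<notin> tspan t M UNIV"
proof
  assume "t a b \<in> tspan t M UNIV"
  then have "- t a b \<in> tspan t M UNIV" by (rule subspace_neg[OF subspace_tspan])
  moreover obtain C where "\<And>w b. w \<in> tspan t M UNIV \<Longrightarrow> norm b \<le> C * norm (w + t a b)"
    by (rule tensor_complement_bound[OF assms(1-3)]) auto
  ultimately have "norm b \<le> C * norm (- t a b + t a b)" by blast
  then show False using assms(4) by simp
qed

lemma tspan_UN:
  assumes mono: "\<And>i. V i \<subseteq> V (Suc i)"
  shows "tspan t (\<Union>i. V i) UNIV = (\<Union>i::nat. tspan t (V i) UNIV)"
proof (intro equalityI subsetI)
  have V_mono: "V m \<subseteq> V n" if "m \<le> n" for m n
    using lift_Suc_mono_le[of V m n] mono that by simp
  fix x assume "x \<in> tspan t (\<Union>i. V i) UNIV"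
  then have "x \<in> span {t a b | a b. a \<in> (\<Union>i. V i)}" by (simp add: tspan_eq_span)
  then show "x \<in> (\<Union>i. tspan t (V i) UNIV)"
  proof (induction rule: span_induct_alt)
    case base
    then show ?case using subspace_0[OF subspace_tspan] by blast
  next
    case (step c x y)
    then obtain a b i j where "x = t a b" "a \<in> V i" "y \<in> tspan t (V j) UNIV" by blast
    moreover have "V i \<subseteq> V (max i j)" "V j \<subseteq> V (max i j)" by (simp_all add: V_mono)
    ultimately have "x \<in> tspan t (V (max i j)) UNIV" "y \<in> tspan t (V (max i j)) UNIV"
      using t_mem_tspan[of a "V (max i j)" b] tspan_mono[of "V j" "V (max i j)"] by blast+
    then have "c *\<^sub>R x + y \<in> tspan t (V (max i j)) UNIV"
      by (intro subspace_add subspace_scale subspace_tspan)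
    then show ?case by blast
  qed
next
  fix x assume "x \<in> (\<Union>i. tspan t (V i) UNIV)"
  then show "x \<in> tspan t (\<Union>i. V i) UNIV" using tspan_mono[of _ "\<Union>i. V i"] by blast
qed

text \<open>By the crossnorm identity \<open>t a b\<close> depends continuously on \<open>a\<close>,
  so the closure contains all elementary tensors; being a closed subspace, it contains everything
  they generate.\<close>

lemma closure_tspan:
  assumes S: "closure S = UNIV" and completion: "closure (tspan t UNIV UNIV) = UNIV"
  shows "closure (tspan t S UNIV) = UNIV"
proof -
  let ?C = "closure (tspan t S UNIV)"
  have "t a b \<in> ?C" for a b
  proof (unfold closure_approachable, intro allI impI)
    fix e :: real assume e: "0 < e"
    have "a \<in> closure S" using S by simp
    then obtain a' where a': "a' \<in> S" "dist a' a < e / (norm b + 1)"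
      unfolding closure_approachable using e by (meson add_nonneg_pos divide_pos_pos norm_ge_zero zero_less_one)
    have "dist (t a' b) (t a b) = dist a' a * norm b"
      by (simp add: dist_norm t_diff1[symmetric] crossnorm)
    also have "\<dots> \<le> dist a' a * (norm b + 1)" by (intro mult_left_mono) auto
    also have "\<dots> < e"
      using a'(2) pos_less_divide_eq[of "norm b + 1" "dist a' a" e] norm_ge_zero[of b] by linarith
    finally show "\<exists>y\<in>tspan t S UNIV. dist y (t a b) < e" using t_mem_tspan[OF a'(1)] by blast
  qed
  then have "tspan t UNIV UNIV \<subseteq> ?C"
    unfolding tspan_eq_span[of UNIV] by (intro span_minimal subspace_closure_subspace subspace_tspan) auto
  then have "closure (tspan t UNIV UNIV) \<subseteq> ?C" by (intro closure_minimal) auto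
  then show ?thesis using completion by auto
qed

end

section \<open>Approximation by an increasing sequence of closed subspaces\<close>

text \<open>Pass to logarithms. A number \<open>c < 1\<close> strictly above the liminf supplies
  \<open>d = - ln c\<close>; conversely \<open>exp (- d)\<close> stays below 1.\<close>

lemma liminf_powr_less_1_iff:
  fixes E \<phi> :: "nat \<Rightarrow> real"
  assumes E: "\<And>n. 0 \<le> E n" and \<phi>: "\<And>n. 0 < \<phi> n"
  shows "liminf (\<lambda>n. ereal (E n powr \<phi> n)) < 1
    \<longleftrightarrow> (\<exists>d>0. \<exists>\<^sub>F n in sequentially. E n \<le> exp (- d / \<phi> n))"
proof -
  \<comment> \<open>If \<open>E n = 0\<close> both sides hold, since \<open>0 powr a = 0\<close>;
    only the other case may take logarithms.\<close>
  have eq: "E n \<le> exp (- d / \<phi> n) \<longleftrightarrow> E n powr \<phi> n \<le> exp (- d)" for n d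
  proof (cases "E n = 0")
    case False
    have "E n \<le> exp (- d / \<phi> n) \<longleftrightarrow> ln (E n) \<le> - d / \<phi> n"
      using False E[of n] ln_le_cancel_iff[of "E n" "exp (- d / \<phi> n)"] by (simp add: less_le)
    also have "\<dots> \<longleftrightarrow> \<phi> n * ln (E n) \<le> - d"
      using \<phi>[of n] by (simp add: field_simps)
    also have "\<dots> \<longleftrightarrow> E n powr \<phi> n \<le> exp (- d)"
      using False by (simp add: powr_def)
    finally show ?thesis .
  qed simp
  show ?thesis unfolding eq
  proof
    assume "liminf (\<lambda>n. ereal (E n powr \<phi> n)) < 1"
    then obtain c where c: "liminf (\<lambda>n. ereal (E n powr \<phi> n)) < ereal c" "ereal c < 1"
      using ereal_dense2 by blast
    have freq: "\<exists>\<^sub>F n in sequentially. E n powr \<phi> n < c"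
    proof (rule ccontr)
      assume "\<not> ?thesis"
      then have "\<forall>\<^sub>F n in sequentially. ereal c \<le> ereal (E n powr \<phi> n)"
        by (simp add: not_frequently not_less)
      then have "ereal c \<le> liminf (\<lambda>n. ereal (E n powr \<phi> n))" by (rule Liminf_bounded)
      with c(1) show False by simp
    qed
    obtain n where "E n powr \<phi> n < c" using frequently_ex[OF freq] by blast
    then have "0 < c" using powr_ge_zero[of "E n" "\<phi> n"] by linarith
    then have "- ln c > 0" using c(2) by simp
    moreover have "\<exists>\<^sub>F n in sequentially. E n powr \<phi> n \<le> exp (- (- ln c))"
      using freq by (rule frequently_elim1) (use \<open>0 < c\<close> in simp)
    ultimately show "\<exists>d>0. \<exists>\<^sub>F n in sequentially. E n powr \<phi> n \<le> exp (- d)" by blast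
  next
    assume "\<exists>d>0. \<exists>\<^sub>F n in sequentially. E n powr \<phi> n \<le> exp (- d)"
    then obtain d where d: "d > 0" "\<exists>\<^sub>F n in sequentially. E n powr \<phi> n \<le> exp (- d)" by blast
    have "\<not> 1 \<le> liminf (\<lambda>n. ereal (E n powr \<phi> n))"
    proof
      assume "1 \<le> liminf (\<lambda>n. ereal (E n powr \<phi> n))"
      then have "\<forall>y<1. \<forall>\<^sub>F n in sequentially. y < ereal (E n powr \<phi> n)"
        by (simp add: le_Liminf_iff)
      moreover have "ereal (exp (- d)) < 1" using d(1) by simp
      ultimately have "\<forall>\<^sub>F n in sequentially. ereal (exp (- d)) < ereal (E n powr \<phi> n)" by blast
      then show False using d(2) by (simp add: frequently_def not_le)
    qed
    then show "liminf (\<lambda>n. ereal (E n powr \<phi> n)) < 1" by simp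
  qed
qed

text \<open>With \<open>d\<close> existential, rescaling \<open>\<phi>\<close> by a positive
  constant does not change the set, which is why inclusions correspond to domination up to a
  constant.\<close>

definition decay_set :: "(nat \<Rightarrow> 'x::real_normed_vector set) \<Rightarrow> (nat \<Rightarrow> real) \<Rightarrow> 'x set" where
  "decay_set W \<phi> = {x. \<exists>d>0. \<exists>\<^sub>F n in sequentially. infdist x (W n) \<le> exp (- d / \<phi> n)}"

lemma B_phi_eq_decay_set:
  assumes "\<And>n. 0 < \<phi> n" shows "B_phi t V \<phi> = decay_set (\<lambda>n. tspan t (V n) UNIV) \<phi>"
  unfolding B_phi_def decay_set_def E_n_def
  by (subst liminf_powr_less_1_iff) (auto simp: assms infdist_nonneg)

section \<open>Comparison and countable bounds of scale functions\<close>

lemma scale_fun_pos: "scale_fun \<phi> \<Longrightarrow> 0 < \<phi> n"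
  and scale_fun_antimono: "scale_fun \<phi> \<Longrightarrow> m \<le> n \<Longrightarrow> \<phi> n \<le> \<phi> m"
  and scale_fun_tendsto: "scale_fun \<phi> \<Longrightarrow> \<phi> \<longlonglongrightarrow> 0"
  by (auto simp: scale_fun_def antimono_def)

lemma scale_fun_eventually_less:
  assumes "scale_fun \<phi>" "0 < \<epsilon>" shows "\<forall>\<^sub>F n in sequentially. \<phi> n < \<epsilon>"
  using order_tendstoD(2)[OF scale_fun_tendsto[OF assms(1)] assms(2)] .

text \<open>Before the threshold \<open>N\<close>, monotonicity bounds \<open>\<psi>\<close> by
  \<open>\<psi> 0\<close> and \<open>\<phi>\<close> from below by \<open>\<phi> N\<close>, so a
  larger constant covers the initial segment.\<close>

lemma scale_fun_dominated_iff:
  assumes \<phi>: "scale_fun \<phi>" and \<psi>: "scale_fun \<psi>"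
  shows "(\<exists>c>0. \<forall>n. \<psi> n \<le> c * \<phi> n) \<longleftrightarrow> (\<exists>c>0. \<forall>\<^sub>F n in sequentially. \<psi> n \<le> c * \<phi> n)"
proof
  assume "\<exists>c>0. \<forall>\<^sub>F n in sequentially. \<psi> n \<le> c * \<phi> n"
  then obtain c N where c: "c > 0" "\<And>n. n \<ge> N \<Longrightarrow> \<psi> n \<le> c * \<phi> n"
    by (auto simp: eventually_sequentially)
  define c' where "c' = max c (\<psi> 0 / \<phi> N)"
  have "\<psi> n \<le> c' * \<phi> n" for n
  proof (cases "n \<ge> N")
    case True
    then show ?thesis
      using c(2)[of n] scale_fun_pos[OF \<phi>, of n] by (simp add: c'_def max_def mult_right_mono order_trans)
  next
    case False
    have "\<psi> n \<le> (\<psi> 0 / \<phi> N) * \<phi> N"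
      using scale_fun_antimono[OF \<psi>, of 0 n] scale_fun_pos[OF \<phi>, of N] by simp
    also have "\<dots> \<le> c' * \<phi> n"
      using False c(1) scale_fun_pos[OF \<phi>, of N] scale_fun_antimono[OF \<phi>, of n N]
      by (intro mult_mono) (auto simp: c'_def)
    finally show ?thesis .
  qed
  moreover have "c' > 0" using c by (simp add: c'_def)
  ultimately show "\<exists>c>0. \<forall>n. \<psi> n \<le> c * \<phi> n" by blast
qed auto

text \<open>A diagonal minimum over \<open>k \<le> n\<close>: moving to a larger \<open>n\<close>
  lowers every entry and adds new ones, so monotonicity survives.\<close>

lemma scale_fun_lower:
  fixes F :: "nat \<Rightarrow> nat \<Rightarrow> real"
  assumes F: "\<And>k. scale_fun (F k)"
  obtains \<phi> where "scale_fun \<phi>" "\<And>k. \<forall>\<^sub>F n in sequentially. \<phi> n \<le> F k n"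
proof -
  define \<phi> where "\<phi> n = Min ((\<lambda>k. F k n) ` {..n})" for n
  have le: "\<phi> n \<le> F k n" if "k \<le> n" for k n
    unfolding \<phi>_def using that by (intro Min_le) auto
  have ev: "\<forall>\<^sub>F n in sequentially. \<phi> n \<le> F k n" for k
    using eventually_ge_at_top[of k] by eventually_elim (rule le)
  have pos: "0 < \<phi> n" for n
    unfolding \<phi>_def by (subst Min_gr_iff) (auto simp: scale_fun_pos[OF F])
  have "antimono \<phi>"
  proof (rule antimonoI)
    fix m n :: nat assume mn: "m \<le> n"
    have "\<phi> n \<le> F k m" if "k \<le> m" for k
      using le[of k n] scale_fun_antimono[OF F mn, of k] that mn by simp
    then show "\<phi> n \<le> \<phi> m" unfolding \<phi>_def[of m] by (subst Min_ge_iff) auto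
  qed
  moreover have "\<phi> \<longlonglongrightarrow> 0"
    by (rule tendsto_sandwich[OF _ ev[of 0] tendsto_const scale_fun_tendsto[OF F]])
      (simp add: pos less_imp_le)
  ultimately have "scale_fun \<phi>" using pos by (simp add: scale_fun_def)
  then show ?thesis using ev by (rule that)
qed

text \<open>A diagonal maximum could jump up whenever a new index enters. Instead, each
  \<open>F k\<close> is cut off at \<open>(1/2) ^ k\<close> before the supremum over all
  \<open>k\<close>. The cut is eventually inactive for fixed \<open>k\<close>, and it leaves only
  finitely many relevant \<open>k\<close> for each \<open>e\<close>, so the supremum tends to
  0.\<close>

lemma scale_fun_upper:
  fixes F :: "nat \<Rightarrow> nat \<Rightarrow> real"
  assumes F: "\<And>k. scale_fun (F k)"
  obtains \<phi> where "scale_fun \<phi>" "\<And>k. \<forall>\<^sub>F n in sequentially. F k n \<le> \<phi> n"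
proof -
  define G where "G k n = min (F k n) ((1/2) ^ k)" for k n
  define \<phi> where "\<phi> n = (SUP k. G k n)" for n
  have G: "0 < G k n" "G k n \<le> (1/2) ^ k" for k n
    by (auto simp: G_def scale_fun_pos[OF F])
  have bdd: "bdd_above (range (\<lambda>k. G k n))" for n
  proof (rule bdd_aboveI2)
    show "G k n \<le> 1" for k
      using G(2)[of k n] power_le_one[of "1/2::real" k] by simp
  qed
  have le: "G k n \<le> \<phi> n" for k n
    unfolding \<phi>_def by (rule cSUP_upper[OF UNIV_I bdd])
  have ev: "\<forall>\<^sub>F n in sequentially. F k n \<le> \<phi> n" for k
  proof -
    have "\<forall>\<^sub>F n in sequentially. F k n < (1/2) ^ k"
      by (rule scale_fun_eventually_less[OF F]) simp
    then show ?thesis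
    proof eventually_elim
      case (elim n)
      then show ?case using le[of k n] by (simp add: G_def)
    qed
  qed
  have anti: "antimono \<phi>"
  proof (rule antimonoI)
    fix m n :: nat assume "m \<le> n"
    then have "G k n \<le> \<phi> m" for k
      using le[of k m] scale_fun_antimono[OF F, of m n k] by (simp add: G_def min_def split: if_splits)
    then show "\<phi> n \<le> \<phi> m" unfolding \<phi>_def[of n] by (intro cSUP_least) auto
  qed
  have pos: "0 < \<phi> n" for n using G(1) le by (rule less_le_trans)
  have "\<phi> \<longlonglongrightarrow> 0"
  proof (rule order_tendstoI)
    fix e :: real assume e: "0 < e"
    obtain K where K: "(1/2::real) ^ K < e / 2"
      using real_arch_pow_inv[of "e/2" "1/2"] e by auto
    have "\<forall>\<^sub>F n in sequentially. \<forall>k\<in>{..<K}. F k n < e / 2"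
      by (intro eventually_ball_finite ballI scale_fun_eventually_less[OF F]) (use e in auto)
    then show "\<forall>\<^sub>F n in sequentially. \<phi> n < e"
    proof eventually_elim
      case (elim n)
      have "G k n \<le> e / 2" for k
      proof (cases "k < K")
        case True
        then show ?thesis using elim by (auto simp: G_def min_def less_imp_le dest!: bspec)
      next
        case False
        then have "(1/2::real) ^ k \<le> (1/2) ^ K" by (intro power_decreasing) auto
        then show ?thesis using G(2)[of k n] K by linarith
      qed
      then have "\<phi> n \<le> e / 2" unfolding \<phi>_def by (intro cSUP_least) auto
      then show ?case using e by simp
    qed
  next
    fix a :: real assume "a < 0"
    then show "\<forall>\<^sub>F n in sequentially. a < \<phi> n"
      using pos by (intro always_eventually allI) (rule less_trans)
  qed
  then have "scale_fun \<phi>" using anti pos by (simp add: scale_fun_def)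
  then show ?thesis using ev by (rule that)
qed

lemma decay_set_mono:
  assumes \<phi>: "\<And>n. 0 < \<phi> n" and \<psi>: "\<And>n. 0 < \<psi> n"
    and c: "c > 0" "\<forall>\<^sub>F n in sequentially. \<psi> n \<le> c * \<phi> n"
  shows "decay_set W \<psi> \<subseteq> decay_set W \<phi>"
proof
  fix x assume "x \<in> decay_set W \<psi>"
  then obtain d where d: "d > 0" "\<exists>\<^sub>F n in sequentially. infdist x (W n) \<le> exp (- d / \<psi> n)"
    by (auto simp: decay_set_def)
  have "\<exists>\<^sub>F n in sequentially. infdist x (W n) \<le> exp (- (d / c) / \<phi> n)"
  proof (rule frequently_rev_mp[OF d(2)], rule eventually_mono[OF c(2)], rule impI)
    fix n assume n: "\<psi> n \<le> c * \<phi> n" and le: "infdist x (W n) \<le> exp (- d / \<psi> n)"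
    have "d / (c * \<phi> n) \<le> d / \<psi> n"
      using n d(1) \<psi>[of n] by (intro divide_left_mono) (auto intro: mult_pos_pos \<phi> c)
    then show "infdist x (W n) \<le> exp (- (d / c) / \<phi> n)"
      using le by (simp add: order_trans)
  qed
  then show "x \<in> decay_set W \<phi>" using d(1) c(1) by (auto simp: decay_set_def intro!: exI[of _ "d/c"])
qed

section \<open>Decay sets of a strictly increasing sequence of closed subspaces with dense
  union\<close>

locale closed_filtration =
  fixes W :: "nat \<Rightarrow> 'x::banach set"
  assumes subspace_W: "subspace (W n)" and closed_W: "closed (W n)"
    and strict_W: "W n \<subset> W (Suc n)" and dense_W: "closure (\<Union>n. W n) = UNIV"
begin

lemma W_mono: "m \<le> n \<Longrightarrow> W m \<subseteq> W n"
  using lift_Suc_mono_le[of W m n] strict_W by (simp add: psubset_eq)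

lemma infdist_W_antimono: "m \<le> n \<Longrightarrow> infdist x (W n) \<le> infdist x (W m)"
  using W_mono[of m n] subspace_0[OF subspace_W] by (intro infdist_mono) auto

lemma infdist_W_tendsto: "(\<lambda>n. infdist x (W n)) \<longlonglongrightarrow> 0"
proof (rule order_tendstoI)
  fix e :: real assume "0 < e"
  moreover have "x \<in> closure (\<Union>n. W n)" using dense_W by simp
  ultimately obtain y m where y: "y \<in> W m" "dist y x < e"
    unfolding closure_approachable by blast
  have "infdist x (W n) < e" if "m \<le> n" for n
    using infdist_le[of y "W n" x] W_mono[OF that] y by (auto simp: dist_commute)
  then show "\<forall>\<^sub>F n in sequentially. infdist x (W n) < e"
    unfolding eventually_sequentially by blast
next
  fix a :: real assume "a < 0"
  then show "\<forall>\<^sub>F n in sequentially. a < infdist x (W n)"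
    by (intro always_eventually allI less_le_trans[OF _ infdist_nonneg])
qed

lemma mem_W_iff: "x \<in> W n \<longleftrightarrow> infdist x (W n) = 0"
  using in_closed_iff_infdist_zero[OF closed_W] subspace_0[OF subspace_W] by blast

lemma Union_W_subset_decay_set: "(\<Union>n. W n) \<subseteq> decay_set W \<phi>"
proof
  fix x assume "x \<in> (\<Union>n. W n)"
  then obtain m where m: "x \<in> W m" by blast
  have "\<forall>\<^sub>F n in sequentially. infdist x (W n) \<le> exp (- 1 / \<phi> n)"
    using eventually_ge_at_top[of m]
  proof eventually_elim
    case (elim n)
    then have "x \<in> W n" using W_mono m by blast
    then show ?case by simp
  qed
  then show "x \<in> decay_set W \<phi>"
    unfolding decay_set_def by (auto intro!: exI[of _ 1] eventually_frequently)
qed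

text \<open>\<open>G k\<close> asks for the rate \<open>d = 1\<close> at some index from
  \<open>k\<close> on. Strictness of the inequality makes it open, and positivity of the threshold
  puts every \<open>W n\<close> inside it, so it is dense.\<close>

lemma decay_set_comeager:
  obtains G where "\<And>k. open (G k)" "\<And>k. closure (G k) = UNIV" "(\<Inter>k::nat. G k) \<subseteq> decay_set W \<phi>"
proof -
  define G where "G k = (\<Union>n\<in>{k..}. {x. infdist x (W n) < exp (- 1 / \<phi> n)})" for k
  have "open (G k)" for k
    unfolding G_def by (intro open_UN ballI open_Collect_less continuous_intros)
  moreover have "closure (G k) = UNIV" for k
  proof -
    have "W n \<subseteq> G k" for n
    proof
      fix x assume "x \<in> W n"
      then have "x \<in> W (max n k)" using W_mono[of n "max n k"] by auto
      then have "infdist x (W (max n k)) < exp (- 1 / \<phi> (max n k))" by simp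
      then show "x \<in> G k" unfolding G_def by (intro UN_I[of "max n k"]) auto
    qed
    then have "closure (\<Union>n. W n) \<subseteq> closure (G k)" by (intro closure_mono) auto
    then show ?thesis using dense_W by auto
  qed
  moreover have "(\<Inter>k. G k) \<subseteq> decay_set W \<phi>"
  proof
    fix x assume "x \<in> (\<Inter>k. G k)"
    then have "\<forall>k. \<exists>n\<ge>k. infdist x (W n) < exp (- 1 / \<phi> n)" by (auto simp: G_def)
    then have "\<exists>\<^sub>F n in sequentially. infdist x (W n) \<le> exp (- 1 / \<phi> n)"
      unfolding frequently_sequentially by (meson less_imp_le)
    then show "x \<in> decay_set W \<phi>" unfolding decay_set_def by (auto intro!: exI[of _ 1])
  qed
  ultimately show ?thesis by (rule that)
qed

text \<open>The scale is read off from the errors of \<open>x\<close> themselves, as the reciprocal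
  of their negative logarithm.\<close>

lemma mem_some_decay_set: "\<exists>\<phi>. scale_fun \<phi> \<and> x \<in> decay_set W \<phi>"
proof (cases "x \<in> (\<Union>n. W n)")
  case True
  have "scale_fun (\<lambda>n. inverse (real (Suc n)))"
    unfolding scale_fun_def using LIMSEQ_inverse_real_of_nat
    by (auto simp: antimono_def intro!: le_imp_inverse_le)
  then show ?thesis using True Union_W_subset_decay_set by blast
next
  case False
  define E where "E n = infdist x (W n)" for n
  have E: "0 < E n" for n using False mem_W_iff infdist_nonneg[of x "W n"] by (auto simp: E_def less_le)
  have Eanti: "E n \<le> E m" if "m \<le> n" for m n unfolding E_def by (rule infdist_W_antimono[OF that])
  \<comment> \<open>Once \<open>\<phi> n < 1\<close> the maximum is inactive and
    \<open>exp (- 1 / \<phi> n) = E n\<close>; before that it keeps \<open>\<phi>\<close>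
    positive.\<close>
  define \<phi> where "\<phi> n = 1 / max 1 (- ln (E n))" for n
  have anti: "antimono \<phi>"
  proof (rule antimonoI)
    fix m n :: nat assume "m \<le> n"
    then have "max 1 (- ln (E m)) \<le> max 1 (- ln (E n))" using Eanti E by (intro max.mono) auto
    then show "\<phi> n \<le> \<phi> m" unfolding \<phi>_def by (intro divide_left_mono) auto
  qed
  have small: "\<forall>\<^sub>F n in sequentially. \<phi> n < e" if e: "e > 0" for e
  proof -
    have "\<forall>\<^sub>F n in sequentially. E n < exp (- 1 / e)"
      using order_tendstoD(2)[OF infdist_W_tendsto[of x], of "exp (- 1 / e)"] by (simp add: E_def)
    then show ?thesis
    proof eventually_elim
      case (elim n)
      then have "ln (E n) < - 1 / e" using E[of n] by (metis ln_exp ln_less_cancel_iff exp_gt_zero)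
      define M where "M = max 1 (- ln (E n))"
      have "1 / e < M" "1 \<le> M" using \<open>ln (E n) < - 1 / e\<close> by (simp_all add: M_def)
      then have "1 / M < e" using e by (simp add: field_simps)
      then show "\<phi> n < e" by (simp add: \<phi>_def M_def)
    qed
  qed
  have pos: "0 < \<phi> n" for n by (simp add: \<phi>_def)
  have "\<phi> \<longlonglongrightarrow> 0"
  proof (rule order_tendstoI)
    fix a :: real assume "a < 0"
    then show "\<forall>\<^sub>F n in sequentially. a < \<phi> n"
      using pos by (intro always_eventually allI) (rule less_trans)
  qed (rule small)
  then have "scale_fun \<phi>" using anti pos by (simp add: scale_fun_def)
  moreover have "x \<in> decay_set W \<phi>"
  proof -
    have "\<forall>\<^sub>F n in sequentially. infdist x (W n) \<le> exp (- 1 / \<phi> n)"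
      using small[of 1, OF zero_less_one]
    proof eventually_elim
      case (elim n)
      then have "\<phi> n = 1 / - ln (E n)" by (auto simp: \<phi>_def max_def split: if_splits)
      then show ?case using E[of n] by (simp add: E_def)
    qed
    then show ?thesis unfolding decay_set_def by (auto intro!: exI[of _ 1] eventually_frequently)
  qed
  ultimately show ?thesis by blast
qed

text \<open>For \<open>x\<close> outside every \<open>W n\<close>, a single scale must defeat all
  \<open>d\<close> at once. Squaring an unbounded majorant \<open>K\<close> of
  \<open>- ln (E n)\<close> does so: \<open>d * (K n)\<^sup>2\<close> exceeds \<open>K n\<close> as
  soon as \<open>d * K n > 1\<close>.\<close>

lemma Union_W_eq_Inter_decay_set: "(\<Union>n. W n) = (\<Inter>\<phi>\<in>{\<phi>. scale_fun \<phi>}. decay_set W \<phi>)"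
proof (intro equalityI INT_greatest Union_W_subset_decay_set subsetI)
  fix x assume x: "x \<in> (\<Inter>\<phi>\<in>{\<phi>. scale_fun \<phi>}. decay_set W \<phi>)"
  show "x \<in> (\<Union>n. W n)"
  proof (rule ccontr)
    assume nx: "x \<notin> (\<Union>n. W n)"
    define E where "E n = infdist x (W n)" for n
    have E: "0 < E n" for n using nx mem_W_iff infdist_nonneg[of x "W n"] by (auto simp: E_def less_le)
    have Eanti: "E n \<le> E m" if "m \<le> n" for m n unfolding E_def by (rule infdist_W_antimono[OF that])
    \<comment> \<open>The summand \<open>real n\<close> gives an explicit rate of growth; the
      maximum with 0 copes with errors above 1.\<close>
    define K where "K n = 1 + max 0 (- ln (E n)) + real n" for n
    have K: "real (Suc n) \<le> K n" "- ln (E n) < K n" for n by (auto simp: K_def)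
    have Kpos: "0 < K n" for n using K(1)[of n] by simp
    have Kmono: "K m \<le> K n" if "m \<le> n" for m n
      unfolding K_def using Eanti[OF that] E that by (intro add_mono max.mono) auto
    define \<phi> where "\<phi> n = 1 / (K n)\<^sup>2" for n
    have "antimono \<phi>"
      unfolding \<phi>_def using Kmono Kpos
      by (intro antimonoI divide_left_mono power_mono mult_pos_pos zero_less_power) (auto intro: less_imp_le)
    moreover have "\<phi> \<longlonglongrightarrow> 0"
    proof (rule tendsto_sandwich[OF _ _ tendsto_const LIMSEQ_inverse_real_of_nat])
      have "real (Suc n) \<le> (K n)\<^sup>2" for n
      proof -
        have "real (Suc n) * 1 \<le> K n * K n" using K(1)[of n] by (intro mult_mono) auto
        then show ?thesis by (simp add: power2_eq_square)
      qed
      then show "\<forall>\<^sub>F n in sequentially. \<phi> n \<le> inverse (real (Suc n))"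
        unfolding \<phi>_def inverse_eq_divide by (intro always_eventually allI divide_left_mono mult_pos_pos zero_less_power) (auto simp: Kpos)
    qed (simp add: \<phi>_def)
    moreover have "0 < \<phi> n" for n using Kpos[of n] by (simp add: \<phi>_def)
    ultimately have "scale_fun \<phi>" by (simp add: scale_fun_def)
    then obtain d where d: "d > 0" "\<exists>\<^sub>F n in sequentially. E n \<le> exp (- d / \<phi> n)"
      using x by (auto simp: decay_set_def E_def)
    obtain N where N: "1 < d * real N" using d(1) by (metis mult.commute ex_less_of_nat_mult)
    have "\<forall>\<^sub>F n in sequentially. exp (- d / \<phi> n) < E n"
      using eventually_ge_at_top[of N]
    proof eventually_elim
      case (elim n)
      have "1 < d * K n"
        using N elim K(1)[of n] mult_left_mono[of "real N" "K n" d] d(1) by linarith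
      then have "1 * K n < d * K n * K n" using Kpos by (intro mult_strict_right_mono) auto
      then have "- ln (E n) < d * (K n)\<^sup>2" using K(2)[of n] by (simp add: power2_eq_square mult.assoc)
      then have "exp (- (d * (K n)\<^sup>2)) < exp (ln (E n))" by simp
      then show ?case using E[of n] by (simp add: \<phi>_def)
    qed
    with d(2) show False by (simp add: frequently_def not_le)
  qed
qed

text \<open>Riesz's lemma: a point \<open>w\<close> at less than twice the distance from
  \<open>y\<close> replaces a nearest point, whence the constant \<open>1/2\<close>.\<close>

lemma exists_far_unit:
  obtains u where "u \<in> W (Suc n)" "norm u \<le> 1" "1/2 \<le> infdist u (W n)"
proof -
  obtain y where y: "y \<in> W (Suc n)" "y \<notin> W n" using strict_W by blast
  have ne: "W n \<noteq> {}" using subspace_0[OF subspace_W] by blast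
  have pos: "0 < infdist y (W n)" using y mem_W_iff infdist_nonneg[of y "W n"] by (auto simp: less_le)
  then have "(INF a\<in>W n. dist y a) < 2 * infdist y (W n)" by (simp add: infdist_notempty[OF ne])
  then obtain w where w: "w \<in> W n" "dist y w < 2 * infdist y (W n)"
    using cINF_less_iff[OF ne, of "dist y"] by (auto intro: bdd_belowI2[of _ 0])
  have yw: "norm (y - w) > 0" using w y by auto
  define u where "u = (1 / norm (y - w)) *\<^sub>R (y - w)"
  have "w \<in> W (Suc n)" using w(1) strict_W by blast
  then have uW: "u \<in> W (Suc n)"
    unfolding u_def using y(1) by (intro subspace_scale subspace_diff subspace_W)
  have "infdist (y - w) (W n) = infdist y (W n)"
    using infdist_subspace_add_mem[OF subspace_W subspace_neg[OF subspace_W w(1)], of y] by simp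
  then have "infdist u (W n) = infdist y (W n) / norm (y - w)"
    unfolding u_def by (simp add: infdist_subspace_scale[OF subspace_W])
  moreover have "1/2 \<le> infdist y (W n) / norm (y - w)"
    using w(2) yw by (simp add: dist_norm field_simps)
  ultimately have "1/2 \<le> infdist u (W n)" by simp
  moreover have "norm u \<le> 1" using yw by (simp add: u_def)
  ultimately show ?thesis using uW by (intro that)
qed

text \<open>A lacunary substitute for Bernstein's lethargy theorem: the rates are prescribed up to
  constants, and \<open>e (Suc j) \<le> e j / 8\<close> makes the \<open>j\<close>-th term of the series dominate its tail.\<close>

lemma exists_lacunary_approximation:
  fixes e :: "nat \<Rightarrow> real" and r :: "nat \<Rightarrow> nat"
  assumes e: "\<And>j. 0 < e j" "\<And>j. e (Suc j) \<le> e j / 8" and r: "strict_mono r"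
  obtains x where "\<And>j. infdist x (W (r j)) \<le> 2 * e j"
    "\<And>j n. n < r (Suc j) \<Longrightarrow> e j / 4 \<le> infdist x (W n)"
proof -
  have "\<exists>u. u \<in> W (r (Suc j)) \<and> norm u \<le> 1 \<and> 1/2 \<le> infdist u (W (r (Suc j) - 1))" for j
  proof -
    have "r j < r (Suc j)" using r by (simp add: strict_mono_Suc_iff)
    then have "Suc (r (Suc j) - 1) = r (Suc j)" by simp
    then show ?thesis using exists_far_unit[of "r (Suc j) - 1"] by metis
  qed
  then obtain u where u: "\<And>j. u j \<in> W (r (Suc j))" "\<And>j. norm (u j) \<le> 1"
      "\<And>j. 1/2 \<le> infdist (u j) (W (r (Suc j) - 1))" by metis
  have e_le: "e (i + j) \<le> e j * (1/8) ^ i" for i j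
  proof (induction i)
    case (Suc i)
    then show ?case using e(2)[of "i + j"] by simp
  qed simp
  define s where "s j = (\<lambda>i. e (i + j) *\<^sub>R u (i + j))" for j
  have s_le: "norm (s j i) \<le> e j * (1/8) ^ i" for j i
  proof -
    have "norm (s j i) \<le> e (i + j) * 1"
      unfolding s_def using e(1)[of "i + j"] u(2)[of "i + j"] by (simp add: mult_left_le)
    then show ?thesis using e_le[of i j] by simp
  qed
  have geo: "summable (\<lambda>i. e j * (1/8) ^ i)" "(\<Sum>i. e j * (1/8) ^ i) = e j * (8/7)" for j
    using suminf_geometric[of "1/8::real"] by (simp_all add: summable_geometric suminf_mult)
  have sum: "summable (s j)" for j
    by (rule summable_comparison_test'[OF geo(1)[of j]]) (use s_le in auto)
  have tail: "norm (suminf (s j)) \<le> e j * (8/7)" for j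
    unfolding geo(2)[symmetric] by (rule norm_suminf_le[OF s_le geo(1)])
  define x where "x = suminf (s 0)"
  have split: "infdist x (W n) = infdist (suminf (s j)) (W n)" if "r j \<le> n" for j n
  proof -
    have "suminf (s j) = (\<Sum>i. s 0 (i + j))" by (simp add: s_def)
    then have "x = suminf (s j) + (\<Sum>i<j. s 0 i)"
      using suminf_split_initial_segment[OF sum[of 0], of j] by (simp only: x_def)
    moreover have "(\<Sum>i<j. s 0 i) \<in> W n"
    proof (rule subspace_sum[OF subspace_W])
      fix i assume "i \<in> {..<j}"
      then have "r (Suc i) \<le> r j" using strict_mono_leD[OF r, of "Suc i" j] by simp
      then have "r (Suc i) \<le> n" using that by simp
      then have "u i \<in> W n" using u(1)[of i] W_mono[of "r (Suc i)" n] by blast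
      then show "s 0 i \<in> W n" by (simp add: s_def subspace_scale subspace_W)
    qed
    ultimately show ?thesis by (simp add: infdist_subspace_add_mem[OF subspace_W])
  qed
  show ?thesis
  proof (rule that[of x])
    fix j
    have "infdist x (W (r j)) \<le> norm (suminf (s j))"
      unfolding split[OF order_refl] by (rule infdist_subspace_le_norm[OF subspace_W])
    then show "infdist x (W (r j)) \<le> 2 * e j" using tail[of j] e(1)[of j] by simp
  next
    fix j n assume n: "n < r (Suc j)"
    \<comment> \<open>This is the last index before \<open>u j\<close> is absorbed, so it carries
      the weakest bound; smaller \<open>n\<close> follow by monotonicity of the errors.\<close>
    let ?N = "r (Suc j) - 1"
    have "r j < r (Suc j)" using r by (simp add: strict_mono_Suc_iff)
    then have "infdist x (W ?N) = infdist (suminf (s j)) (W ?N)" by (intro split) simp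
    also have "suminf (s j) = suminf (s (Suc j)) + e j *\<^sub>R u j"
      using suminf_split_head[OF sum[of j]] by (simp add: s_def)
    finally have "infdist x (W ?N) = infdist (suminf (s (Suc j)) + e j *\<^sub>R u j) (W ?N)" .
    moreover have "infdist (e j *\<^sub>R u j) (W ?N)
        \<le> infdist (suminf (s (Suc j)) + e j *\<^sub>R u j) (W ?N) + norm (suminf (s (Suc j)))"
      using infdist_triangle[of "e j *\<^sub>R u j" "W ?N" "suminf (s (Suc j)) + e j *\<^sub>R u j"]
      by (simp add: dist_norm)
    moreover have "infdist (e j *\<^sub>R u j) (W ?N) \<ge> e j * (1/2)"
      unfolding infdist_subspace_scale[OF subspace_W] using e(1)[of j] u(3)[of j]
      by (simp add: mult_left_mono)
    \<comment> \<open>The tail has norm at most \<open>8/7 * e (Suc j)\<close>, hence at most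
      \<open>e j / 7\<close>, and \<open>1/2 - 1/7\<close> exceeds \<open>1/4\<close>.\<close>
    ultimately have "e j / 4 \<le> infdist x (W ?N)"
      using tail[of "Suc j"] e(2)[of j] e(1)[of j] by linarith
    also have "\<dots> \<le> infdist x (W n)" using n by (intro infdist_W_antimono) simp
    finally show "e j / 4 \<le> infdist x (W n)" .
  qed
qed

text \<open>The set of \<open>\<psi>\<close> only has to be hit at the indices \<open>r j\<close>,
  whereas avoiding that of \<open>\<phi>\<close> concerns every late \<open>n\<close>. On the block
  from \<open>r j\<close> up to \<open>r (Suc j)\<close> the error does not drop below
  \<open>e j / 4\<close>, and \<open>\<phi> n \<le> \<phi> (r j)\<close> carries the comparison made
  at \<open>r j\<close> through the whole block.\<close>

lemma decay_set_not_subset: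
  assumes \<phi>: "scale_fun \<phi>" and \<psi>: "scale_fun \<psi>"
    and nle: "\<not> (\<exists>c>0. \<forall>n. \<psi> n \<le> c * \<phi> n)"
  shows "\<not> decay_set W \<psi> \<subseteq> decay_set W \<phi>"
proof -
  have ex: "\<exists>n>N. c * \<phi> n < \<psi> n \<and> 1 / \<psi> n \<ge> b" if c: "c > 0" for c b N
  proof -
    have "\<not> (\<forall>\<^sub>F n in sequentially. \<psi> n \<le> c * \<phi> n)"
      using nle c unfolding scale_fun_dominated_iff[OF \<phi> \<psi>] by blast
    then have "\<exists>\<^sub>F n in sequentially. c * \<phi> n < \<psi> n" by (simp add: not_eventually not_le)
    moreover have "\<forall>\<^sub>F n in sequentially. N < n \<and> \<psi> n < 1 / max 1 b"
      by (intro eventually_conj eventually_gt_at_top scale_fun_eventually_less[OF \<psi>]) simp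
    ultimately obtain n where n: "c * \<phi> n < \<psi> n" "N < n" "\<psi> n < 1 / max 1 b"
      using frequently_ex[OF frequently_eventually_frequently] by blast
    have "\<psi> n * max 1 b < 1" using n(3) by (subst (asm) pos_less_divide_eq) auto
    then have "max 1 b < 1 / \<psi> n"
      using scale_fun_pos[OF \<psi>, of n] by (simp only: pos_less_divide_eq mult.commute)
    then show ?thesis using n by auto
  qed
  \<comment> \<open>The growing factor \<open>Suc j\<close> sends the ratio of the scales to
    infinity along \<open>r\<close>; the gap \<open>ln 8\<close> becomes the factor
    \<open>1/8\<close> after exponentiation.\<close>
  have "\<exists>r. \<forall>j. (real (Suc j) * \<phi> (r j) < \<psi> (r j)) \<and> (r j < r (Suc j) \<and> 1 / \<psi> (r j) + ln 8 \<le> 1 / \<psi> (r (Suc j)))"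
  proof (rule dependent_nat_choice)
    show "\<exists>n. real (Suc 0) * \<phi> n < \<psi> n" using ex[of "real (Suc 0)"] by auto
    show "\<exists>n. real (Suc (Suc j)) * \<phi> n < \<psi> n \<and> m < n \<and> 1 / \<psi> m + ln 8 \<le> 1 / \<psi> n" for m j
      using ex[of "real (Suc (Suc j))" m "1 / \<psi> m + ln 8"] by auto
  qed
  then obtain r where ratio: "\<And>j. real (Suc j) * \<phi> (r j) < \<psi> (r j)" and r: "strict_mono r"
    and gap: "\<And>j. 1 / \<psi> (r j) + ln 8 \<le> 1 / \<psi> (r (Suc j))"
    by (auto simp: strict_mono_Suc_iff)
  define e where "e j = exp (- 1 / \<psi> (r j))" for j
  have e_pos: "0 < e j" for j by (simp add: e_def)
  have e_step: "e (Suc j) \<le> e j / 8" for j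
  proof -
    have "e (Suc j) \<le> exp (- 1 / \<psi> (r j) - ln 8)" unfolding e_def using gap[of j] by simp
    then show ?thesis by (simp add: e_def exp_diff)
  qed
  obtain x where upper: "\<And>j. infdist x (W (r j)) \<le> 2 * e j"
    and lower: "\<And>j n. n < r (Suc j) \<Longrightarrow> e j / 4 \<le> infdist x (W n)"
    using exists_lacunary_approximation[of e r, OF e_pos e_step r] by blast
  have \<psi>r: "\<forall>\<^sub>F j in sequentially. \<psi> (r j) < b" if "b > 0" for b
    using eventually_subseq[OF r scale_fun_eventually_less[OF \<psi> that]] .
  have "x \<in> decay_set W \<psi>"
  proof -
    \<comment> \<open>Below this threshold \<open>ln 2 \<le> 1 / (2 * \<psi> (r j))\<close>, so half
      of the rate pays for the factor 2 in \<open>upper\<close>.\<close>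
    have "0 < 1 / (2 * ln 2 :: real)" by simp
    from \<psi>r[OF this]
    have "\<forall>\<^sub>F j in sequentially. infdist x (W (r j)) \<le> exp (- (1/2) / \<psi> (r j))"
    proof eventually_elim
      case (elim j)
      then have "ln 2 - 1 / \<psi> (r j) \<le> - (1/2) / \<psi> (r j)"
        using scale_fun_pos[OF \<psi>, of "r j"] by (simp add: field_simps)
      then have "exp (ln 2 - 1 / \<psi> (r j)) \<le> exp (- (1/2) / \<psi> (r j))" by simp
      moreover have "infdist x (W (r j)) \<le> exp (ln 2 - 1 / \<psi> (r j))"
        using upper[of j] by (simp add: e_def exp_diff exp_minus divide_inverse)
      ultimately show ?case by linarith
    qed
    then obtain J where J: "\<And>j. j \<ge> J \<Longrightarrow> infdist x (W (r j)) \<le> exp (- (1/2) / \<psi> (r j))"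
      by (auto simp: eventually_sequentially)
    have "\<exists>n\<ge>N. infdist x (W n) \<le> exp (- (1/2) / \<psi> n)" for N
    proof -
      have "N \<le> r (max J N)"
        using strict_mono_imp_increasing[OF r, of "max J N"] by simp
      then show ?thesis using J[of "max J N"] by auto
    qed
    then show ?thesis
      unfolding decay_set_def frequently_sequentially by (auto intro!: exI[of _ "1/2"])
  qed
  moreover have "x \<notin> decay_set W \<phi>"
  proof
    assume "x \<in> decay_set W \<phi>"
    then obtain d where d: "d > 0" "\<exists>\<^sub>F n in sequentially. infdist x (W n) \<le> exp (- d / \<phi> n)"
      by (auto simp: decay_set_def)
    obtain J0 where J0: "2 < d * real J0"
      using d(1) by (metis divide_less_eq mult.commute reals_Archimedean2)
    obtain J1 where J1: "\<And>j. j \<ge> J1 \<Longrightarrow> \<psi> (r j) < 1 / ln 4"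
      using \<psi>r[of "1 / ln 4"] by (auto simp: eventually_sequentially)
    define J where "J = max J0 J1"
    have "\<forall>\<^sub>F n in sequentially. exp (- d / \<phi> n) < infdist x (W n)"
      using eventually_ge_at_top[of "r J"]
    proof eventually_elim
      case (elim n)
      \<comment> \<open>The index of the block containing \<open>n\<close>; for \<open>j = 0\<close>
        the lower end comes from \<open>r J \<le> n\<close>.\<close>
      define j where "j = (LEAST j. n < r (Suc j))"
      have "n < r (Suc n)" using strict_mono_imp_increasing[OF r, of "Suc n"] by simp
      then have nj: "n < r (Suc j)" unfolding j_def by (rule LeastI)
      have jn: "r j \<le> n"
      proof (cases j)
        case 0
        then show ?thesis using elim r by (meson le0 order_trans strict_mono_leD)
      next
        case (Suc i)
        then show ?thesis using not_less_Least[of i "\<lambda>j. n < r (Suc j)"] by (simp add: j_def)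
      qed
      have "J < Suc j" using elim nj r by (metis le_less_trans strict_mono_less)
      then have jJ: "J0 \<le> j" "J1 \<le> j" by (auto simp: J_def)
      have pos: "0 < \<psi> (r j)" "0 < \<phi> (r j)" "0 < \<phi> n" using \<phi> \<psi> by (auto intro: scale_fun_pos)
      have "real (Suc j) * (1 / \<psi> (r j)) \<le> 1 / \<phi> (r j)"
        using ratio[of j] pos by (simp add: field_simps)
      have "d * real J0 \<le> d * real (Suc j)" using d(1) jJ by (intro mult_left_mono) auto
      then have "2 < d * real (Suc j)" using J0 by linarith
      then have "2 * (1 / \<psi> (r j)) < d * real (Suc j) * (1 / \<psi> (r j))"
        using pos by (intro mult_strict_right_mono) auto
      also have "d * real (Suc j) * (1 / \<psi> (r j)) \<le> d * (1 / \<phi> (r j))"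
        using \<open>real (Suc j) * (1 / \<psi> (r j)) \<le> 1 / \<phi> (r j)\<close> d(1)
        by (simp only: mult.assoc mult_left_mono less_imp_le)
      also have "\<dots> \<le> d * (1 / \<phi> n)"
        using scale_fun_antimono[OF \<phi> jn] pos d(1) by (simp add: field_simps)
      finally have "2 / \<psi> (r j) < d / \<phi> n" by simp
      \<comment> \<open>One of the two copies of \<open>1 / \<psi> (r j)\<close> absorbs the factor
        4 lost in \<open>lower\<close>; this is why \<open>J0\<close> was chosen with 2 rather than
        1.\<close>
      moreover have "ln 4 < 1 / \<psi> (r j)" using J1[OF jJ(2)] pos by (simp add: field_simps)
      ultimately have "exp (- d / \<phi> n) < exp (- 1 / \<psi> (r j) - ln 4)" by simp
      also have "\<dots> = e j / 4" by (simp add: e_def exp_diff)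
      also have "\<dots> \<le> infdist x (W n)" by (rule lower[OF nj])
      finally show ?case .
    qed
    with d(2) show False by (simp add: frequently_def not_le)
  qed
  ultimately show ?thesis by blast
qed

lemma decay_set_subset_iff:
  assumes "scale_fun \<phi>" "scale_fun \<psi>"
  shows "decay_set W \<psi> \<subseteq> decay_set W \<phi> \<longleftrightarrow> (\<exists>c>0. \<forall>n. \<psi> n \<le> c * \<phi> n)"
  using decay_set_not_subset[OF assms] decay_set_mono[of \<phi> \<psi> _ W] assms[THEN scale_fun_pos]
  by (meson always_eventually)

text \<open>The ratio of \<open>\<phi>\<close> to its square is \<open>1 / \<phi> n\<close>, which
  is unbounded, while the square is at most \<open>\<phi> 0 * \<phi> n\<close>.\<close>

lemma decay_set_square_psubset:
  assumes \<phi>: "scale_fun \<phi>" and \<phi>2: "scale_fun (\<lambda>n. (\<phi> n)\<^sup>2)"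
  shows "decay_set W (\<lambda>n. (\<phi> n)\<^sup>2) \<subset> decay_set W \<phi>"
proof -
  have "(\<phi> n)\<^sup>2 \<le> \<phi> 0 * \<phi> n" for n
    using scale_fun_pos[OF \<phi>, of n] scale_fun_antimono[OF \<phi>, of 0 n] by (simp add: power2_eq_square)
  then have "decay_set W (\<lambda>n. (\<phi> n)\<^sup>2) \<subseteq> decay_set W \<phi>"
    using decay_set_subset_iff[OF \<phi> \<phi>2] scale_fun_pos[OF \<phi>] by blast
  moreover have "\<not> (\<exists>c>0. \<forall>n. \<phi> n \<le> c * (\<phi> n)\<^sup>2)"
  proof safe
    fix c :: real assume c: "c > 0" "\<forall>n. \<phi> n \<le> c * (\<phi> n)\<^sup>2"
    obtain n where n: "\<phi> n < 1 / c"
      using scale_fun_eventually_less[OF \<phi>, of "1 / c"] c(1) by (auto simp: eventually_sequentially)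
    have "1 \<le> c * \<phi> n"
      using c(2)[rule_format, of n] scale_fun_pos[OF \<phi>, of n] by (simp add: power2_eq_square)
    then show False using n c(1) by (simp add: field_simps)
  qed
  then have "\<not> decay_set W \<phi> \<subseteq> decay_set W (\<lambda>n. (\<phi> n)\<^sup>2)"
    using decay_set_subset_iff[OF \<phi>2 \<phi>] by blast
  ultimately show ?thesis by blast
qed

end

section \<open>Squares and roots of scale functions, and the theorem for tensor products\<close>

lemma scale_fun_square: assumes "scale_fun \<phi>" shows "scale_fun (\<lambda>n. (\<phi> n)\<^sup>2)"
  unfolding scale_fun_def
proof (intro conjI allI antimonoI)
  show "(\<phi> n)\<^sup>2 \<le> (\<phi> m)\<^sup>2" if "m \<le> n" for m n
    using scale_fun_antimono[OF assms that] scale_fun_pos[OF assms, of n] by (intro power_mono) auto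
  show "0 < (\<phi> n)\<^sup>2" for n using scale_fun_pos[OF assms, of n] by simp
  show "(\<lambda>n. (\<phi> n)\<^sup>2) \<longlonglongrightarrow> 0"
    using tendsto_power[OF scale_fun_tendsto[OF assms], of 2] by simp
qed

lemma scale_fun_sqrt: assumes "scale_fun \<phi>" shows "scale_fun (\<lambda>n. sqrt (\<phi> n))"
  unfolding scale_fun_def
  using tendsto_real_sqrt[OF scale_fun_tendsto[OF assms]] scale_fun_antimono[OF assms] scale_fun_pos[OF assms]
  by (auto simp: antimono_def)

text \<open>Infinite dimension and separability of the first factor are carried by the strictly
  increasing finite spans with dense union. If \<open>'b\<close> were zero, the whole product would
  be zero and the strict inclusions would fail. In the third claim an empty \<open>\<Phi>\<close>
  would make the intersection everything and the union empty.\<close>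

theorem theorem2p2:
  fixes smulA :: "'k::real_normed_field \<Rightarrow> 'a::banach \<Rightarrow> 'a"
    and smulB :: "'k \<Rightarrow> 'b::banach \<Rightarrow> 'b"
    and smulX :: "'k \<Rightarrow> 'x::banach \<Rightarrow> 'x"
    and t :: "'a \<Rightarrow> 'b \<Rightarrow> 'x"
    and V :: "nat \<Rightarrow> 'a set"
  assumes A: "F_normed_space smulA"
    and B: "F_normed_space smulB"
    and X: "F_normed_space smulX"
    and B_nontrivial: "\<exists>b::'b. b \<noteq> 0"
    and V_fin: "\<And>i. \<exists>S. finite S \<and> V i = F_span smulA S"
    and V_strict: "\<And>i. V i \<subset> V (Suc i)"
    and V_dense: "closure (\<Union>i. V i) = UNIV"
    and t_add1: "\<And>a a' b. t (a + a') b = t a b + t a' b"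
    and t_add2: "\<And>a b b'. t a (b + b') = t a b + t a b'"
    and t_smul1: "\<And>c a b. t (smulA c a) b = smulX c (t a b)"
    and t_smul2: "\<And>c a b. t a (smulB c b) = smulX c (t a b)"
    and crossnorm: "\<And>a b. norm (t a b) = norm a * norm b"
    and dual_crossnorm: "\<And>f g. F_functional smulA f \<Longrightarrow> F_functional smulB g \<Longrightarrow>
          \<exists>h. F_functional smulX h \<and> (\<forall>a b. h (t a b) = f a * g b) \<and>
              onorm h = onorm f * onorm g"
    and completion: "closure (tspan t UNIV UNIV) = UNIV"
  shows
    "(\<forall>\<phi>. scale_fun \<phi> \<longrightarrow>
        (\<exists>G :: nat \<Rightarrow> 'x set. (\<forall>k. open (G k) \<and> closure (G k) = UNIV) \<and>
           (\<Inter>k. G k) \<subseteq> B_phi t V \<phi>))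
     \<and> (UNIV = (\<Union>\<phi>\<in>{\<phi>. scale_fun \<phi>}. B_phi t V \<phi>)
        \<and> tspan t (\<Union>i. V i) UNIV = (\<Inter>\<phi>\<in>{\<phi>. scale_fun \<phi>}. B_phi t V \<phi>)
        \<and> (\<forall>\<Phi>. countable \<Phi> \<and> (\<forall>\<phi>\<in>\<Phi>. scale_fun \<phi>) \<longrightarrow>
              UNIV - (\<Union>\<phi>\<in>\<Phi>. B_phi t V \<phi>) \<noteq> {}))
     \<and> (\<forall>\<Phi>. countable \<Phi> \<and> \<Phi> \<noteq> {} \<and> (\<forall>\<phi>\<in>\<Phi>. scale_fun \<phi>) \<longrightarrow>
          (\<exists>\<phi>lb \<phi>ub. scale_fun \<phi>lb \<and> scale_fun \<phi>ub \<and>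
             B_phi t V \<phi>lb \<subseteq> (\<Inter>\<phi>\<in>\<Phi>. B_phi t V \<phi>) \<and>
             (\<Inter>\<phi>\<in>\<Phi>. B_phi t V \<phi>) \<subseteq> (\<Union>\<phi>\<in>\<Phi>. B_phi t V \<phi>) \<and>
             (\<Union>\<phi>\<in>\<Phi>. B_phi t V \<phi>) \<subseteq> B_phi t V \<phi>ub))
     \<and> (\<forall>\<phi> \<phi>'. scale_fun \<phi> \<and> scale_fun \<phi>' \<longrightarrow>
          (B_phi t V \<phi>' \<subseteq> B_phi t V \<phi> \<longleftrightarrow> (\<exists>c>0. \<forall>n. \<phi>' n \<le> c * \<phi> n)))
     \<and> (\<forall>\<phi>. scale_fun \<phi> \<longrightarrow>
          B_phi t V (\<lambda>n. (\<phi> n)\<^sup>2) \<subset> B_phi t V \<phi> \<and>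
          B_phi t V \<phi> \<subset> B_phi t V (\<lambda>n. sqrt (\<phi> n)))"
proof -
  interpret reasonable_crossnorm smulA smulB smulX t
    by unfold_locales (fact A B X t_add1 t_add2 t_smul1 t_smul2 crossnorm dual_crossnorm)+
  define W where "W n = tspan t (V n) UNIV" for n
  have V_sub: "F_subspace smulA (V n)" and V_closed: "closed (V n)" and W_closed: "closed (W n)" for n
    using V_fin[of n] closed_F_span_tspan F_subspace_F_span[OF A] unfolding W_def by metis+
  have Union: "(\<Union>i. W i) = tspan t (\<Union>i. V i) UNIV"
    unfolding W_def using tspan_UN[of V] V_strict by blast
  interpret closed_filtration W
  proof
    show "subspace (W n)" "closed (W n)" for n
      using W_closed by (simp_all add: W_def subspace_tspan)
    show "W n \<subset> W (Suc n)" for n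
    proof -
      obtain a where a: "a \<in> V (Suc n)" "a \<notin> V n" using V_strict[of n] by blast
      obtain b :: 'b where b: "b \<noteq> 0" using B_nontrivial by blast
      have "t a b \<notin> W n" unfolding W_def by (rule t_notin_tspan[OF V_sub V_closed a(2) b])
      moreover have "t a b \<in> W (Suc n)" unfolding W_def by (rule t_mem_tspan[OF a(1)])
      moreover have "W n \<subseteq> W (Suc n)" unfolding W_def using V_strict[of n] by (intro tspan_mono) blast
      ultimately show ?thesis by blast
    qed
    show "closure (\<Union>n. W n) = UNIV"
      unfolding Union by (rule closure_tspan[OF V_dense completion])
  qed
  have D: "B_phi t V \<phi> = decay_set W \<phi>" if "scale_fun \<phi>" for \<phi>
    using B_phi_eq_decay_set[of \<phi> t V] scale_fun_pos[OF that] unfolding W_def by blast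
  have bounds: "\<exists>\<phi>lb \<phi>ub. scale_fun \<phi>lb \<and> scale_fun \<phi>ub \<and>
      (\<forall>\<phi>\<in>\<Phi>. decay_set W \<phi>lb \<subseteq> decay_set W \<phi> \<and> decay_set W \<phi> \<subseteq> decay_set W \<phi>ub)"
    if \<Phi>: "countable \<Phi>" "\<Phi> \<noteq> {}" "\<forall>\<phi>\<in>\<Phi>. scale_fun \<phi>" for \<Phi> :: "(nat \<Rightarrow> real) set"
  proof -
    let ?F = "from_nat_into \<Phi>"
    have range: "range ?F = \<Phi>" by (rule range_from_nat_into[OF \<Phi>(2,1)])
    then have F: "scale_fun (?F k)" for k using \<Phi>(3) by auto
    obtain \<phi>lb where lb: "scale_fun \<phi>lb" "\<And>k. \<forall>\<^sub>F n in sequentially. \<phi>lb n \<le> ?F k n"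
      using scale_fun_lower[of ?F, OF F] by blast
    obtain \<phi>ub where ub: "scale_fun \<phi>ub" "\<And>k. \<forall>\<^sub>F n in sequentially. ?F k n \<le> \<phi>ub n"
      using scale_fun_upper[of ?F, OF F] by blast
    have "decay_set W \<phi>lb \<subseteq> decay_set W (?F k)" "decay_set W (?F k) \<subseteq> decay_set W \<phi>ub" for k
      using decay_set_mono[OF scale_fun_pos[OF F[of k]] scale_fun_pos[OF lb(1)] zero_less_one, where W = W]
        decay_set_mono[OF scale_fun_pos[OF ub(1)] scale_fun_pos[OF F[of k]] zero_less_one, where W = W]
        lb(2)[of k] ub(2)[of k] by simp_all
    then have "\<forall>\<phi>\<in>range ?F. decay_set W \<phi>lb \<subseteq> decay_set W \<phi> \<and> decay_set W \<phi> \<subseteq> decay_set W \<phi>ub"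
      by blast
    then show ?thesis using lb(1) ub(1) unfolding range by blast
  qed
  have sq: "decay_set W (\<lambda>n. (\<phi> n)\<^sup>2) \<subset> decay_set W \<phi>" if "scale_fun \<phi>" for \<phi>
    by (rule decay_set_square_psubset[OF that scale_fun_square[OF that]])
  have sqrt: "decay_set W \<phi> \<subset> decay_set W (\<lambda>n. sqrt (\<phi> n))" if "scale_fun \<phi>" for \<phi>
  proof -
    \<comment> \<open>The square-root inclusion is the square inclusion applied to the square root
      of \<open>\<phi>\<close>.\<close>
    have "(\<lambda>n. (sqrt (\<phi> n))\<^sup>2) = \<phi>" using scale_fun_pos[OF that] by (simp add: less_imp_le)
    then show ?thesis using sq[OF scale_fun_sqrt[OF that]] by simp
  qed
  show ?thesis
  proof (intro conjI allI impI)
    fix \<phi> :: "nat \<Rightarrow> real" assume \<phi>: "scale_fun \<phi>"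
    obtain G where "\<And>k. open (G k)" "\<And>k. closure (G k) = UNIV" "(\<Inter>k::nat. G k) \<subseteq> decay_set W \<phi>"
      using decay_set_comeager[of \<phi>] by blast
    then show "\<exists>G. (\<forall>k::nat. open (G k) \<and> closure (G k) = UNIV) \<and> (\<Inter>k. G k) \<subseteq> B_phi t V \<phi>"
      unfolding D[OF \<phi>] by blast
    show "B_phi t V (\<lambda>n. (\<phi> n)\<^sup>2) \<subset> B_phi t V \<phi>"
      using sq[OF \<phi>] by (simp add: D \<phi> scale_fun_square)
    show "B_phi t V \<phi> \<subset> B_phi t V (\<lambda>n. sqrt (\<phi> n))"
      using sqrt[OF \<phi>] by (simp add: D \<phi> scale_fun_sqrt)
  next
    show "UNIV = (\<Union>\<phi>\<in>{\<phi>. scale_fun \<phi>}. B_phi t V \<phi>)"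
      using mem_some_decay_set D by auto
    show "tspan t (\<Union>i. V i) UNIV = (\<Inter>\<phi>\<in>{\<phi>. scale_fun \<phi>}. B_phi t V \<phi>)"
      using Union_W_eq_Inter_decay_set D by (simp add: Union)
  next
    fix \<Phi> :: "(nat \<Rightarrow> real) set" assume \<Phi>: "countable \<Phi> \<and> (\<forall>\<phi>\<in>\<Phi>. scale_fun \<phi>)"
    show "UNIV - (\<Union>\<phi>\<in>\<Phi>. B_phi t V \<phi>) \<noteq> {}"
    proof (cases "\<Phi> = {}")
      case False
      then obtain \<phi>ub where ub: "scale_fun \<phi>ub" "\<forall>\<phi>\<in>\<Phi>. decay_set W \<phi> \<subseteq> decay_set W \<phi>ub"
        using bounds[of \<Phi>] \<Phi> by blast
      \<comment> \<open>The set of the upper bound lies strictly inside that of its square root, so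
        it omits a point.\<close>
      obtain x where "x \<notin> decay_set W \<phi>ub" using sqrt[OF ub(1)] by blast
      then have "x \<notin> B_phi t V \<phi>" if "\<phi> \<in> \<Phi>" for \<phi>
        using ub(2) D[of \<phi>] \<Phi> that by blast
      then show ?thesis by blast
    qed simp
  next
    fix \<Phi> :: "(nat \<Rightarrow> real) set"
    assume \<Phi>: "countable \<Phi> \<and> \<Phi> \<noteq> {} \<and> (\<forall>\<phi>\<in>\<Phi>. scale_fun \<phi>)"
    obtain \<phi>lb \<phi>ub where b: "scale_fun \<phi>lb" "scale_fun \<phi>ub"
      "\<forall>\<phi>\<in>\<Phi>. decay_set W \<phi>lb \<subseteq> decay_set W \<phi> \<and> decay_set W \<phi> \<subseteq> decay_set W \<phi>ub"
      using bounds[of \<Phi>] \<Phi> by blast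
    have D\<Phi>: "B_phi t V \<phi> = decay_set W \<phi>" if "\<phi> \<in> \<Phi>" for \<phi> using \<Phi> D that by blast
    have "B_phi t V \<phi>lb \<subseteq> (\<Inter>\<phi>\<in>\<Phi>. B_phi t V \<phi>)" "(\<Union>\<phi>\<in>\<Phi>. B_phi t V \<phi>) \<subseteq> B_phi t V \<phi>ub"
      using b(3) by (auto simp: D b(1,2) D\<Phi>)
    moreover have "(\<Inter>\<phi>\<in>\<Phi>. B_phi t V \<phi>) \<subseteq> (\<Union>\<phi>\<in>\<Phi>. B_phi t V \<phi>)" using \<Phi> by blast
    ultimately show "\<exists>\<phi>lb \<phi>ub. scale_fun \<phi>lb \<and> scale_fun \<phi>ub \<and>
        B_phi t V \<phi>lb \<subseteq> (\<Inter>\<phi>\<in>\<Phi>. B_phi t V \<phi>) \<and>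
        (\<Inter>\<phi>\<in>\<Phi>. B_phi t V \<phi>) \<subseteq> (\<Union>\<phi>\<in>\<Phi>. B_phi t V \<phi>) \<and>
        (\<Union>\<phi>\<in>\<Phi>. B_phi t V \<phi>) \<subseteq> B_phi t V \<phi>ub"
      using b(1,2) by blast
  next
    fix \<phi> \<phi>' :: "nat \<Rightarrow> real" assume \<phi>: "scale_fun \<phi> \<and> scale_fun \<phi>'"
    then show "B_phi t V \<phi>' \<subseteq> B_phi t V \<phi> \<longleftrightarrow> (\<exists>c>0. \<forall>n. \<phi>' n \<le> c * \<phi> n)"
      using decay_set_subset_iff[of \<phi> \<phi>'] D by simp
  qed
qed

end
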